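(* Let $\gamma\in[0,2]$, $b,\mu>0$, $\omega>0$ with $\omega^2>2\mu^2$, and $f=\frac{b\mu^3}{\omega^2-2\mu^2}$. Let the functions $\bar\Omega,\bar\Sigma,\bar Q,\bar\Phi$ and $D>0$ of $t$ satisfy the time-averaged Kantowski--Sachs equations $$\dot{\bar\Omega}=\tfrac12 D\,\bar\Omega\Big(\bar Q\big(-3\gamma(\bar\Sigma^2+\bar\Omega^2-1)-2\bar Q\bar\Sigma+6\bar\Sigma^2+3\bar\Omega^2-3\big)+2\bar\Sigma\Big),$$ $$\dot{\bar\Sigma}=\tfrac12 D\Big((\bar\Sigma^2-1)\big(-2\bar Q^2-3(\gamma-2)\bar Q\bar\Sigma+2\big)-3(\gamma-1)\bar Q\bar\Sigma\bar\Omega^2\Big),$$ $$\dot{\bar Q}=-\tfrac12 D(\bar Q^2-1)\Big(3\gamma(\bar\Sigma^2+\bar\Omega^2-1)+2\bar\Sigma(\bar Q-3\bar\Sigma)-3\bar\Omega^2+2\Big),$$ $$\dot{\bar\Phi}=0,$$ $$\dot D=-\tfrac12D^2\Big(2\bar\Sigma(1-\bar Q^2+3\bar Q\bar\Sigma)+3\bar Q\bar\Omega^2+3\gamma\bar Q(1-\bar\Sigma^2-\bar\Omega^2)\Big).$$ Then there exist continuously differentiable functions $g_1,g_2,g_3,g_4$ of $(D,\Omega_0,\Sigma_0,Q_0,\Phi_0,t)$ such that the solution components $\Omega,\Sigma,Q,\Phi$ of the full Kantowski--Sachs system (defined in the context) are locally given by $$(\Omega,\Sigma,Q,\Phi)^T=(\Omega_0,\Sigma_0,Q_0,\Phi_0)^T+D\,\big(g_1,g_2,g_3,g_4\big)^T(D,\Omega_0,\Sigma_0,Q_0,\Phi_0,t),$$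 where $\Omega_0,\Sigma_0,Q_0,\Phi_0$ are order zero approximations of $\bar\Omega,\bar\Sigma,\bar Q,\bar\Phi$ as $D\to0$, and the functions $\Omega_0,\Sigma_0,Q_0,\Phi_0$ and $\bar\Omega,\bar\Sigma,\bar Q,\bar\Phi$ have the same limit on a time scale $tD=\mathcal O(1)$ (in the sense made precise in the context). Setting $\Sigma=\Sigma_0=\bar\Sigma=0$ and dropping the $\Sigma$-equations, the analogous result holds for the positively curved ($k=+1$) Friedmann--Lemaître--Robertson--Walker (FLRW) model.
   Context: **Model.** A scalar field $\phi$ with potential $V(\phi)=\mu^2\phi^2+bf\mu^3\left(1-\cos(\phi/f)\right)$, where $bf\mu^3=f^2(\omega^2-2\mu^2)$, and matter of density $\rho_m$ with pressure $p_m=(\gamma-1)\rho_m$. Dots are $t$-derivatives. For the Kantowski--Sachs metric, with Hubble scalar $H$, shear $\sigma_+$ and Gaussian curvature $K$ of the 2-spheres, the field equations are $$\ddot\phi=-3H\dot\phi-V'(\phi),\quad \dot\rho_m=-3\gamma H\rho_m,\quad \dot K=-2(\sigma_++H)K,$$ $$\dot H=-H^2-2\sigma_+^2-\tfrac16(3\gamma-2)\rho_m-\tfrac13\dot\phi^2+\tfrac13V(\phi),\quad \dot\sigma_+=-3H\sigma_+-\tfrac K3,$$ $$3H^2+K=3\sigma_+^2+\rho_m+\tfrac12\dot\phi^2+V(\phi).$$ Normalized variables: $$D=\sqrt{H^2+K/3},\quad Q=\frac HD,\quad \Sigma=\frac{\sigma_+}{D},\quad \Omega=\sqrt{\frac{\omega^2\phi^2+\dot\phi^2}{6D^2}},\quad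 \Phi=t\omega-\tan^{-1}\!\left(\frac{\omega\phi}{\dot\phi}\right),$$ so that $\phi=\frac{\sqrt6D\Omega}{\omega}\sin\theta$ and $\dot\phi=\sqrt6D\Omega\cos\theta$, with $\theta=t\omega-\Phi$. **Full Kantowski--Sachs system.** This is the resulting system for $(\Omega,\Sigma,Q,\Phi,D)$ with $\rho_m$ eliminated by the constraint. Explicitly, put $\theta=t\omega-\Phi$, $\phi=\frac{\sqrt6D\Omega}{\omega}\sin\theta$, $W=\frac{V(\phi)}{3D^2}$, $m=1-\Sigma^2-\Omega^2\cos^2\theta-W$, $h=-Q^2-2\Sigma^2-\frac{3\gamma-2}{2}m-2\Omega^2\cos^2\theta+W$, and $\delta=Qh-(Q+\Sigma)(1-Q^2)$. Then $$\dot\Omega=\frac{\cos\theta\,(\omega^2\phi-V'(\phi))}{\sqrt6D}-3DQ\Omega\cos^2\theta-D\Omega\delta,$$ $$\dot\Sigma=D\left(-3Q\Sigma-(1-Q^2)-\Sigma\delta\right),\quad \dot Q=D(h-Q\delta),$$ $$\dot\Phi=\frac{\sin\theta\,(\omega^2\phi-V'(\phi))}{\sqrt6D\,\Omega}-3DQ\sin\theta\cos\theta,\quad \dot D=D^2\delta.$$ As $D\to0$ it has the form $\dot{\mathbf x}=D\,\mathbf f(\mathbf x,t)+\mathcal O(D^2)$, $\dot D=\mathcal O(D^2)$, with $\mathbf x=(\Omega,\Sigma,Q,\Phi)^T$ and $\mathbf f$ periodic in $t$. The averaged right-hand side is obtained from $\bar{\mathbf f}(\cdot)=\frac{\omega}{2\pi}\int_0^{2\pi/\omega}\mathbf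 f(\cdot,t)\,dt$ with $\mathbf x$ held fixed. The same symbol $D$ is used for the perturbation function in both systems; in the transformation $\mathbf x=\mathbf x_0+D\mathbf g$ the evolution of $D$ is taken to be the averaged equation for $D$ given in the claim. **Closed FLRW model.** Metric $-dt^2+\ell^2(t)[dr^2+\sin^2r(d\vartheta^2+\sin^2\vartheta\,d\zeta^2)]$, with $$\ddot\phi=-3H\dot\phi-V'(\phi),\quad \dot\rho_m=-3\gamma H\rho_m,\quad \dot\ell=\ell H,$$ $$\dot H=-\tfrac12(\gamma\rho_m+\dot\phi^2)+\ell^{-2},\quad 3H^2=\rho_m+\tfrac12\dot\phi^2+V(\phi)-3\ell^{-2},$$ $D=\sqrt{H^2+\ell^{-2}}$ and $Q,\Omega,\Phi$ defined as before. Its full and averaged systems for $(\Omega,Q,\Phi,D)$ are those above with $\Sigma\equiv0$, $\bar\Sigma\equiv0$ and the $\Sigma$-equations removed. **Meaning of the last assertion.** "$\mathbf x_0=(\Omega_0,\Sigma_0,Q_0,\Phi_0)$ is an order zero approximation of $\bar{\mathbf x}=(\bar\Omega,\bar\Sigma,\bar Q,\bar\Phi)$ as $D\to0$, and the two have the same limit on a time scale $tD=\mathcal O(1)$" means: if $\mathbf x_0(t_n)=\bar{\mathbf x}(t_n)$ at an initial time $t_n$ and $D(t_n)=D_n$, then there is a constant $c>0$ independent of $D_n$ such that $\sup_{t_n\le t\le t_n+c/D_n}|\mathbf x_0(t)-\bar{\mathbf x}(t)|\to0$ as $D_n\to0$. *)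

theory Defs
  imports "HOL-Analysis.Analysis"
begin

definition V :: "real \<Rightarrow> real \<Rightarrow> real \<Rightarrow> real \<Rightarrow> real" where
  "V b \<mu> f \<phi> = \<mu>\<^sup>2 * \<phi>\<^sup>2 + b * f * \<mu> ^ 3 * (1 - cos (\<phi> / f))"

(* The right-hand sides below return the pair (d/dt x, d/dt D), where
   x = (\<Omega>, \<Sigma>, Q, \<Phi>) for Kantowski-Sachs and x = (\<Omega>, Q, \<Phi>) for closed FLRW. *)

fun KS_full ::
  "real \<Rightarrow> real \<Rightarrow> real \<Rightarrow> real \<Rightarrow> real \<Rightarrow> real
   \<Rightarrow> real \<times> real \<times> real \<times> real \<Rightarrow> real \<Rightarrow> (real \<times> real \<times> real \<times> real) \<times> real" where
  "KS_full \<gamma> b \<mu> \<omega> f t (\<Omega>, \<Sigma>, Q, \<Phi>) D =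
    (let \<theta> = t * \<omega> - \<Phi>;
         \<phi> = sqrt 6 * D * \<Omega> / \<omega> * sin \<theta>;
         W = V b \<mu> f \<phi> / (3 * D\<^sup>2);
         m = 1 - \<Sigma>\<^sup>2 - \<Omega>\<^sup>2 * (cos \<theta>)\<^sup>2 - W;
         h = - Q\<^sup>2 - 2 * \<Sigma>\<^sup>2 - (3 * \<gamma> - 2) / 2 * m - 2 * \<Omega>\<^sup>2 * (cos \<theta>)\<^sup>2 + W;
         \<delta> = Q * h - (Q + \<Sigma>) * (1 - Q\<^sup>2);
         F = \<omega>\<^sup>2 * \<phi> - deriv (V b \<mu> f) \<phi>
     in ((cos \<theta> * F / (sqrt 6 * D) - 3 * D * Q * \<Omega> * (cos \<theta>)\<^sup>2 - D * \<Omega> * \<delta>,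
          D * (- 3 * Q * \<Sigma> - (1 - Q\<^sup>2) - \<Sigma> * \<delta>),
          D * (h - Q * \<delta>),
          sin \<theta> * F / (sqrt 6 * D * \<Omega>) - 3 * D * Q * sin \<theta> * cos \<theta>),
         D\<^sup>2 * \<delta>))"

fun KS_averaged ::
  "real \<Rightarrow> real \<times> real \<times> real \<times> real \<Rightarrow> real \<Rightarrow> (real \<times> real \<times> real \<times> real) \<times> real" where
  "KS_averaged \<gamma> (\<Omega>, \<Sigma>, Q, \<Phi>) D =
    ((1/2 * D * \<Omega> * (Q * (- 3 * \<gamma> * (\<Sigma>\<^sup>2 + \<Omega>\<^sup>2 - 1) - 2 * Q * \<Sigma> + 6 * \<Sigma>\<^sup>2 + 3 * \<Omega>\<^sup>2 - 3) + 2 * \<Sigma>),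
      1/2 * D * ((\<Sigma>\<^sup>2 - 1) * (- 2 * Q\<^sup>2 - 3 * (\<gamma> - 2) * Q * \<Sigma> + 2) - 3 * (\<gamma> - 1) * Q * \<Sigma> * \<Omega>\<^sup>2),
      - 1/2 * D * (Q\<^sup>2 - 1) *
        (3 * \<gamma> * (\<Sigma>\<^sup>2 + \<Omega>\<^sup>2 - 1) + 2 * \<Sigma> * (Q - 3 * \<Sigma>) - 3 * \<Omega>\<^sup>2 + 2),
      0),
     - 1/2 * D\<^sup>2 *
        (2 * \<Sigma> * (1 - Q\<^sup>2 + 3 * Q * \<Sigma>) + 3 * Q * \<Omega>\<^sup>2 + 3 * \<gamma> * Q * (1 - \<Sigma>\<^sup>2 - \<Omega>\<^sup>2)))"

fun FLRW_full ::
  "real \<Rightarrow> real \<Rightarrow> real \<Rightarrow> real \<Rightarrow> real \<Rightarrow> real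
   \<Rightarrow> real \<times> real \<times> real \<Rightarrow> real \<Rightarrow> (real \<times> real \<times> real) \<times> real" where
  "FLRW_full \<gamma> b \<mu> \<omega> f t (\<Omega>, Q, \<Phi>) D =
    (let ((\<Omega>', _, Q', \<Phi>'), D') = KS_full \<gamma> b \<mu> \<omega> f t (\<Omega>, 0, Q, \<Phi>) D
     in ((\<Omega>', Q', \<Phi>'), D'))"

fun FLRW_averaged ::
  "real \<Rightarrow> real \<times> real \<times> real \<Rightarrow> real \<Rightarrow> (real \<times> real \<times> real) \<times> real" where
  "FLRW_averaged \<gamma> (\<Omega>, Q, \<Phi>) D =
    (let ((\<Omega>', _, Q', \<Phi>'), D') = KS_averaged \<gamma> (\<Omega>, 0, Q, \<Phi>) D
     in ((\<Omega>', Q', \<Phi>'), D'))"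

definition solution_on ::
  "(real \<Rightarrow> 'a::real_normed_vector \<Rightarrow> real \<Rightarrow> 'a \<times> real) \<Rightarrow> 'a set \<Rightarrow> real set
   \<Rightarrow> (real \<Rightarrow> 'a) \<Rightarrow> (real \<Rightarrow> real) \<Rightarrow> bool" where
  "solution_on F X I x D \<longleftrightarrow>
    (\<forall>t\<in>I. x t \<in> X \<and> 0 < D t \<and>
      (x has_vector_derivative fst (F t (x t) (D t))) (at t within I) \<and>
      (D has_vector_derivative snd (F t (x t) (D t))) (at t within I))"

definition continuously_differentiable ::
  "('a::real_normed_vector \<Rightarrow> 'b::real_normed_vector) \<Rightarrow> bool" where
  "continuously_differentiable g \<longleftrightarrow>
    (\<exists>g'. (\<forall>z. (g has_derivative blinfun_apply (g' z)) (at z)) \<and> continuous_on UNIV g')"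

(* The full system evolves its own D, while the transformation x = x0 + D g uses the D of the
   averaged system (written Da); the two agree at the initial time, as do x0 and the averaged
   solution xa. *)
definition averaging_representation ::
  "(real \<Rightarrow> 'a::real_normed_vector \<Rightarrow> real \<Rightarrow> 'a \<times> real) \<Rightarrow> 'a set \<Rightarrow> ('a \<Rightarrow> real \<Rightarrow> 'a \<times> real)
   \<Rightarrow> (real \<times> 'a \<times> real \<Rightarrow> 'a) \<Rightarrow> real \<Rightarrow> real
   \<Rightarrow> (real \<Rightarrow> 'a) \<Rightarrow> (real \<Rightarrow> real) \<Rightarrow> (real \<Rightarrow> 'a) \<Rightarrow> (real \<Rightarrow> 'a) \<Rightarrow> (real \<Rightarrow> real) \<Rightarrow> bool" where
  "averaging_representation F X A g tn T x D x0 xa Da \<longleftrightarrow>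
    solution_on F X {tn..T} x D \<and>
    solution_on (\<lambda>t. A) UNIV {tn..T} xa Da \<and>
    D tn = Da tn \<and> x0 tn = xa tn \<and>
    x0 differentiable_on {tn..T} \<and>
    (\<forall>t\<in>{tn..T}. x t = x0 t + Da t *\<^sub>R g (Da t, x0 t, t))"

(* Local form of the averaging assertion. Near every state p of the domain X and for small
   initial values Dn of D: solutions of both systems exist on the time scale c / Dn, each of them
   is part of a representation via g on that time scale, and x0 and xa are uniformly close there
   as Dn tends to 0. N is the range of initial values of x0 and xa, M that of x. *)
definition order_zero_averaging ::
  "(real \<Rightarrow> 'a::real_normed_vector \<Rightarrow> real \<Rightarrow> 'a \<times> real) \<Rightarrow> 'a set \<Rightarrow> ('a \<Rightarrow> real \<Rightarrow> 'a \<times> real)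
   \<Rightarrow> (real \<times> 'a \<times> real \<Rightarrow> 'a) \<Rightarrow> bool" where
  "order_zero_averaging F X A g \<longleftrightarrow>
    (\<forall>p\<in>X. \<exists>N M. \<exists>c>0. \<exists>d>0. open N \<and> p \<in> N \<and> open M \<and> p \<in> M \<and>
      (\<forall>tn Dn. 0 < Dn \<and> Dn < d \<longrightarrow>
        (\<forall>\<xi>\<in>N. \<exists>xa Da. solution_on (\<lambda>t. A) UNIV {tn..tn + c / Dn} xa Da \<and>
            xa tn = \<xi> \<and> Da tn = Dn) \<and>
        (\<forall>\<xi>\<in>M. \<exists>x D. solution_on F X {tn..tn + c / Dn} x D \<and> x tn = \<xi> \<and> D tn = Dn) \<and>
        (\<forall>x D. solution_on F X {tn..tn + c / Dn} x D \<and> x tn \<in> M \<and> D tn = Dn \<longrightarrow>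
            (\<exists>x0 xa Da. averaging_representation F X A g tn (tn + c / Dn) x D x0 xa Da \<and>
                xa tn \<in> N)) \<and>
        (\<forall>xa Da. solution_on (\<lambda>t. A) UNIV {tn..tn + c / Dn} xa Da \<and> xa tn \<in> N \<and> Da tn = Dn \<longrightarrow>
            (\<exists>x D x0. averaging_representation F X A g tn (tn + c / Dn) x D x0 xa Da))) \<and>
      (\<forall>\<epsilon>>0. \<exists>e>0. \<forall>tn Dn x D x0 xa Da.
        0 < Dn \<and> Dn < e \<and> xa tn \<in> N \<and> Da tn = Dn \<and>
        averaging_representation F X A g tn (tn + c / Dn) x D x0 xa Da \<longrightarrow>
          (\<forall>t\<in>{tn..tn + c / Dn}. norm (x0 t - xa t) \<le> \<epsilon>)))"

end

(* Write D = \<eta> E with \<eta> the initial value of D and rescale the state to y = (x, E). Then the full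
   system is y' = \<eta> G(t, \<eta>, y) and the averaged one is y' = \<eta> H(y), where G is bounded and
   Lipschitz in all its arguments, up to \<eta> = 0, near (p, 1), because sin z = z - z^2 S(z) and
   cos z = 1 - z^2 C(z) with S and C bounded and Lipschitz. Here the condition on f matters:
   it makes V(\<phi>) = \<omega>^2 \<phi>^2 / 2 to leading order, so H is the time average of G(., 0, .), and
   G(t, 0, y) - H(y) is the t-derivative of a bounded function g(t, y).
   Solutions live on [tn, tn + c / \<eta>] and stay near (p, 1) by Picard's theorem when c is small,
   and y - ya - \<eta> g(t, y) has increments \<eta> O(sup |y - ya| + \<eta>), so that |y - ya| = O(\<eta>).
   This bounds the exact solution itself against the averaged one, so the transformation
   x = x0 + D g of the theorem may be taken with g = 0. *)

theory Submission
  imports Defs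
begin

text \<open>The obstacle is that the full field divides by D, by D^2 and by \<Omega>, so it has no
  direct meaning at D = 0. The second-order remainders of sine and cosine turn these quotients, by
  exact identities for \<Omega> > 0, into expressions that are regular at \<eta> = 0. The variable E
  belongs to the state because D evolves too, and differently in the two systems. Initial times are
  arbitrary, so every constant has to be uniform in t on the whole real line, while \<eta> and the
  state range over bounded sets. The corrector enters through its time derivative and a Lipschitz
  bound in the state. The corrected difference is therefore controlled by its small increments
  instead of a derivative. Since the length of the time interval times \<eta> K is at most 1/2, the
  supremum of the error reappears with a factor 1/2 and is absorbed; this takes the place of a
  Gronwall inequality.\<close>

section \<open>Solutions of ordinary differential equations\<close>

text \<open>The ball is centred at \<open>p\<close> and not at the initial value \<xi>, so that one
  set of constants serves all nearby initial values. \<open>room\<close> makes the Picard operator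
  preserve the ball, and \<open>small\<close> makes it a contraction with factor 1/2 in the supremum
  norm.\<close>

lemma picard_local_existence:
  fixes v :: "real \<Rightarrow> 'y::banach \<Rightarrow> 'y"
  assumes ab: "a \<le> b" and B: "0 \<le> B" and L: "0 \<le> L"
    and cont: "continuous_on ({a..b} \<times> cball p r) (\<lambda>(t, y). v t y)"
    and bound: "\<And>t y. t \<in> {a..b} \<Longrightarrow> y \<in> cball p r \<Longrightarrow> norm (v t y) \<le> B"
    and lip: "\<And>t y z. t \<in> {a..b} \<Longrightarrow> y \<in> cball p r \<Longrightarrow> z \<in> cball p r \<Longrightarrow>
                norm (v t y - v t z) \<le> L * dist y z"
    and room: "dist p \<xi> + B * (b - a) \<le> r" and small: "L * (b - a) \<le> 1/2"
  obtains y where "y a = \<xi>" "\<And>t. t \<in> {a..b} \<Longrightarrow> y t \<in> cball p r"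
    "\<And>t. t \<in> {a..b} \<Longrightarrow> (y has_vector_derivative v t (y t)) (at t within {a..b})"
proof -
  define S where "S = (PiC UNIV (\<lambda>_. cball p r) :: (real \<Rightarrow>\<^sub>C 'y) set)"
  \<comment> \<open>Elements of \<open>bcontfun\<close> live on the whole real line. Clamping the
    upper limit freezes the iterate outside \<open>{a..b}\<close>, which keeps it bounded and
    evaluates \<open>v\<close> only at times where it is controlled.\<close>
  define cl where "cl t = max a (min b t)" for t
  have cl: "cl t \<in> {a..b}" for t using ab by (auto simp: cl_def)
  define op where "op u t = \<xi> + integral {a..cl t} (\<lambda>s. v s (apply_bcontfun u s))" for u t
  have inS: "apply_bcontfun u s \<in> cball p r" if "u \<in> S" for u s
    using that mem_PiCD[of u UNIV "\<lambda>_. cball p r"] by (auto simp: S_def)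
  have cu: "continuous_on {a..b} (\<lambda>s. v s (apply_bcontfun u s))" if "u \<in> S" for u
  proof -
    have "continuous_on {a..b} (\<lambda>s. (s, apply_bcontfun u s))"
      by (intro continuous_on_Pair continuous_on_id continuous_on_apply_bcontfun)
    then have "continuous_on {a..b} (\<lambda>s. case (s, apply_bcontfun u s) of (t, y) \<Rightarrow> v t y)"
      by (rule continuous_on_compose2[OF cont]) (use inS[OF that] in auto)
    then show ?thesis by simp
  qed
  have iu: "(\<lambda>s. v s (apply_bcontfun u s)) integrable_on {a..cl t}" if "u \<in> S" for u t
    using cl by (intro integrable_continuous_real continuous_on_subset[OF cu[OF that]]) auto
  have opball: "op u t \<in> cball p r" if "u \<in> S" for u t
  proof -
    have "norm (integral {a..cl t} (\<lambda>s. v s (apply_bcontfun u s))) \<le> B * (cl t - a)"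
    proof (rule integral_bound)
      show "continuous_on {a..cl t} (\<lambda>s. v s (apply_bcontfun u s))"
        using cl[of t] by (intro continuous_on_subset[OF cu[OF that]]) auto
    qed (use cl[of t] inS[OF that] in \<open>auto intro!: bound\<close>)
    also have "\<dots> \<le> B * (b - a)"
      using cl[of t] B by (intro mult_left_mono) auto
    finally have "dist \<xi> (op u t) \<le> B * (b - a)" by (simp add: op_def dist_norm)
    with room show ?thesis using dist_triangle[of p "op u t" \<xi>] by auto
  qed
  have opc: "op u \<in> bcontfun" if "u \<in> S" for u
  proof -
    have "continuous_on {a..b} (\<lambda>x. integral {a..x} (\<lambda>s. v s (apply_bcontfun u s)))"
      using cu[OF that] by (intro indefinite_integral_continuous_1 integrable_continuous_real)
    then have "continuous_on UNIV (\<lambda>t. integral {a..cl t} (\<lambda>s. v s (apply_bcontfun u s)))"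
      by (rule continuous_on_compose2) (use cl in \<open>auto simp: cl_def intro!: continuous_intros\<close>)
    then have "continuous_on UNIV (op u)"
      unfolding op_def[abs_def] by (intro continuous_intros)
    moreover have "bounded (range (op u))"
      by (rule bounded_subset[OF bounded_cball[of p r]]) (use opball[OF that] in auto)
    ultimately show ?thesis by (simp add: bcontfun_def)
  qed
  define Op where "Op u = Bcontfun (op u)" for u
  have Op: "apply_bcontfun (Op u) = op u" if "u \<in> S" for u
    using opc[OF that] by (simp add: Op_def Bcontfun_inverse)
  have "\<xi> \<in> cball p r"
    using room mult_nonneg_nonneg[of B "b - a"] B ab unfolding mem_cball by linarith
  then have "const_bcontfun \<xi> \<in> S"
    by (auto simp: S_def mem_PiC_iff const_bcontfun.rep_eq)
  then have ne: "S \<noteq> {}" by auto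
  have "\<exists>!u\<in>S. Op u = u"
  proof (rule Banach_fix[of S "1/2"])
    show "complete S"
      unfolding S_def by (intro complete_eq_closed[THEN iffD2] closed_PiC) auto
    show "Op ` S \<subseteq> S"
      using opball by (auto simp: S_def mem_PiC_iff Op[unfolded S_def])
    show "dist (Op u) (Op w) \<le> 1/2 * dist u w" if uw: "u \<in> S" "w \<in> S" for u w
    proof (rule dist_bound)
      fix t
      have "op u t - op w t
          = integral {a..cl t} (\<lambda>s. v s (apply_bcontfun u s) - v s (apply_bcontfun w s))"
        using iu uw by (simp add: op_def integral_diff)
      also have "norm \<dots> \<le> (L * dist u w) * (cl t - a)"
      proof (rule integral_bound)
        show "continuous_on {a..cl t} (\<lambda>s. v s (apply_bcontfun u s) - v s (apply_bcontfun w s))"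
          using cl[of t] uw by (intro continuous_intros continuous_on_subset[OF cu]) auto
        fix s assume s: "s \<in> {a..cl t}"
        have "norm (v s (apply_bcontfun u s) - v s (apply_bcontfun w s))
            \<le> L * dist (apply_bcontfun u s) (apply_bcontfun w s)"
          using s cl[of t] inS uw by (intro lip) auto
        also have "\<dots> \<le> L * dist u w"
          using L by (intro mult_left_mono dist_bounded) auto
        finally show "norm (v s (apply_bcontfun u s) - v s (apply_bcontfun w s)) \<le> L * dist u w" .
      qed (use cl[of t] in auto)
      also have "\<dots> \<le> (L * dist u w) * (b - a)"
        using cl[of t] L by (intro mult_left_mono) auto
      also have "\<dots> = (L * (b - a)) * dist u w" by simp
      also have "\<dots> \<le> 1/2 * dist u w" by (rule mult_right_mono[OF small]) simp
      finally show "dist (apply_bcontfun (Op u) t) (apply_bcontfun (Op w) t) \<le> 1/2 * dist u w"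
        using uw by (simp add: Op dist_norm)
    qed
  qed (use ne in auto)
  then obtain u where u: "u \<in> S" "Op u = u" by auto
  then have ueq: "apply_bcontfun u = op u" using Op by metis
  have *: "apply_bcontfun u t = \<xi> + integral {a..t} (\<lambda>s. v s (apply_bcontfun u s))"
    if "t \<in> {a..b}" for t
    using that fun_cong[OF ueq, of t] by (simp add: op_def cl_def)
  show ?thesis
  proof
    show "apply_bcontfun u a = \<xi>" using *[of a] ab by simp
    show "apply_bcontfun u t \<in> cball p r" for t using inS u by auto
    show "(apply_bcontfun u has_vector_derivative v t (apply_bcontfun u t)) (at t within {a..b})"
      if t: "t \<in> {a..b}" for t
    proof -
      have "((\<lambda>t. \<xi> + integral {a..t} (\<lambda>s. v s (apply_bcontfun u s)))
          has_vector_derivative 0 + v t (apply_bcontfun u t)) (at t within {a..b})"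
        by (intro has_vector_derivative_add has_vector_derivative_const
            integral_has_vector_derivative cu u t)
      then show ?thesis
        by (intro has_vector_derivative_transform[OF t *]) simp_all
    qed
  qed
qed

text \<open>First-exit argument: the speed bound is known only inside the ball, but up to the first
  exit it is available, and the strict inequality in \<open>room\<close> then rules out reaching
  distance \<open>r\<close>.\<close>

lemma stays_in_cball:
  fixes y :: "real \<Rightarrow> 'y::real_inner"
  assumes deriv: "\<And>t. t \<in> {a..b} \<Longrightarrow> (y has_vector_derivative y' t) (at t within {a..b})"
    and bound: "\<And>t. t \<in> {a..b} \<Longrightarrow> y t \<in> cball p r \<Longrightarrow> norm (y' t) \<le> B"
    and B: "0 \<le> B" and room: "dist p (y a) + B * (b - a) < r"
    and t: "t \<in> {a..b}"
  shows "y t \<in> cball p r"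
proof (rule ccontr)
  assume out: "y t \<notin> cball p r"
  have ycont: "continuous_on {a..b} y"
    unfolding continuous_on_eq_continuous_within
    using deriv by (blast intro: has_vector_derivative_continuous)
  \<comment> \<open>Closedness of this set makes its infimum the first time at which the distance
    reaches \<open>r\<close>.\<close>
  define C where "C = {s \<in> {a..t}. r \<le> dist p (y s)}"
  have "closed ({a..t} \<inter> (\<lambda>s. dist p (y s)) -` {r..})"
    using t by (intro continuous_closed_preimage continuous_intros continuous_on_subset[OF ycont]) auto
  also have "{a..t} \<inter> (\<lambda>s. dist p (y s)) -` {r..} = C"
    by (auto simp: C_def)
  finally have "closed C" .
  moreover have "C \<noteq> {}" using out t by (auto simp: C_def)
  moreover have bdd: "bdd_below C" by (auto simp: C_def intro!: bdd_belowI[of _ a])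
  ultimately have inf: "Inf C \<in> C" by (rule closed_contains_Inf[rotated 2])
  define \<tau> where "\<tau> = Inf C"
  have \<tau>: "a \<le> \<tau>" "\<tau> \<le> b" "r \<le> dist p (y \<tau>)" using inf t by (auto simp: C_def \<tau>_def)
  have before: "y s \<in> cball p r" if "a \<le> s" "s < \<tau>" for s
  proof (rule ccontr)
    assume "y s \<notin> cball p r"
    then have "s \<in> C" using that inf by (auto simp: C_def \<tau>_def)
    then show False using cInf_lower[OF _ bdd, of s] that by (auto simp: \<tau>_def)
  qed
  have "dist p (y a) < r"
    using room t mult_nonneg_nonneg[OF B, of "b - a"] by (smt (verit) atLeastAtMost_iff)
  then have "a < \<tau>" using \<tau> by (cases "a = \<tau>") auto
  moreover have "continuous_on {a..\<tau>} y"
    using \<tau> by (intro continuous_on_subset[OF ycont]) auto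
  moreover have "(y has_derivative (\<lambda>h. h *\<^sub>R y' s)) (at s)" if "a < s" "s < \<tau>" for s
    using deriv[of s] that \<tau> at_within_Icc_at[of a s b] by (auto simp: has_vector_derivative_def)
  ultimately obtain s where s: "s \<in> {a<..<\<tau>}" "norm (y \<tau> - y a) \<le> norm ((\<tau> - a) *\<^sub>R y' s)"
    using mvt_general[of a \<tau> y "\<lambda>s h. h *\<^sub>R y' s"] by auto
  have "norm (y' s) \<le> B"
    using s \<tau> before by (intro bound) auto
  then have "norm ((\<tau> - a) *\<^sub>R y' s) \<le> (\<tau> - a) * B"
    using s by (auto intro: mult_left_mono)
  also have "\<dots> \<le> (b - a) * B"
    using \<tau> B by (intro mult_right_mono) auto
  finally have "dist (y a) (y \<tau>) \<le> B * (b - a)"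
    using s by (simp add: dist_norm norm_minus_commute mult.commute)
  then show False
    using room \<tau> dist_triangle[of p "y \<tau>" "y a"] by linarith
qed

text \<open>A mean value inequality for functions that may fail to be differentiable. It is made for
  y - ya - \<eta> g(t, y), where g is merely Lipschitz in y. Bisection in the form of
  \<open>Bolzano\<close> passes from the local estimates to the whole interval.\<close>

lemma pointwise_lipschitz_imp_bound:
  fixes w :: "real \<Rightarrow> 'y::real_normed_vector"
  assumes ab: "a \<le> b"
    and ptw: "\<And>t e. t \<in> {a..b} \<Longrightarrow> 0 < e \<Longrightarrow>
      \<forall>\<^sub>F s in at t within {a..b}. norm (w s - w t) \<le> (k + e) * \<bar>s - t\<bar>"
  shows "norm (w b - w a) \<le> k * (b - a)"
proof (rule field_le_epsilon)
  fix e' :: real assume e': "0 < e'"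
  \<comment> \<open>The summand 1 covers a = b and makes the accumulated error e (b - a) at most
    \<open>e'\<close>.\<close>
  define e where "e = e' / (b - a + 1)"
  have e: "0 < e" using e' ab by (simp add: e_def)
  define P where "P u v \<longleftrightarrow> u \<in> {a..b} \<longrightarrow> v \<in> {a..b} \<longrightarrow> norm (w v - w u) \<le> (k + e) * (v - u)" for u v
  have "P a b"
    using ab
  proof (induction rule: Bolzano)
    case (trans u x v)
    have "norm (w v - w u) \<le> norm (w v - w x) + norm (w x - w u)"
      by (metis norm_triangle_ineq diff_add_cancel add_diff_eq)
    then show ?case using trans by (auto simp: P_def algebra_simps)
  next
    case (local x)
    then obtain d where d: "d > 0"
      "\<And>s. s \<in> {a..b} \<Longrightarrow> dist s x < d \<Longrightarrow> s \<noteq> x \<Longrightarrow> norm (w s - w x) \<le> (k + e) * \<bar>s - x\<bar>"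
      using ptw[of x, OF _ e] by (auto simp: eventually_at)
    have d2: "norm (w s - w x) \<le> (k + e) * \<bar>s - x\<bar>" if "s \<in> {a..b}" "dist s x < d" for s
      using d(2)[of s] that by (cases "s = x") auto
    show ?case
    proof (intro exI[of _ d] conjI allI impI d(1))
      fix u v assume uv: "u \<le> x \<and> x \<le> v \<and> v - u < d"
      have "norm (w v - w u) \<le> norm (w v - w x) + norm (w u - w x)"
        using norm_triangle_ineq4[of "w v - w x" "w u - w x"] by simp
      then show "P u v"
        using d2[of u] d2[of v] uv by (auto simp: P_def dist_real_def algebra_simps)
    qed
  qed
  then have "norm (w b - w a) \<le> (k + e) * (b - a)" using ab by (auto simp: P_def)
  also have "\<dots> = k * (b - a) + e' * ((b - a) / (b - a + 1))"
    by (simp add: e_def algebra_simps)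
  also have "e' * ((b - a) / (b - a + 1)) \<le> e' * 1"
    using e' ab by (intro mult_left_mono) (auto simp: divide_simps)
  finally show "norm (w b - w a) \<le> k * (b - a) + e'" by simp
qed

section \<open>Bounded Lipschitz functions\<close>

text \<open>Boundedness is carried along because products of Lipschitz functions need it to be
  Lipschitz again. This gives closure under all operations that build the model fields, so
  \<open>bl_intros\<close> can follow the shape of a term.\<close>

definition bounded_lipschitz_on :: "'a::metric_space set \<Rightarrow> ('a \<Rightarrow> 'b::real_normed_vector) \<Rightarrow> bool" where
  "bounded_lipschitz_on Z h \<longleftrightarrow>
    (\<exists>K. (\<forall>z\<in>Z. norm (h z) \<le> K) \<and> (\<forall>z\<in>Z. \<forall>w\<in>Z. dist (h z) (h w) \<le> K * dist z w))"

named_theorems bl_intros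

lemma bounded_lipschitz_onI:
  assumes "\<And>z. z \<in> Z \<Longrightarrow> norm (h z) \<le> B"
    and "\<And>z w. z \<in> Z \<Longrightarrow> w \<in> Z \<Longrightarrow> dist (h z) (h w) \<le> L * dist z w"
  shows "bounded_lipschitz_on Z h"
  unfolding bounded_lipschitz_on_def
proof (intro exI[of _ "max B L"] conjI ballI)
  show "norm (h z) \<le> max B L" if "z \<in> Z" for z using assms(1)[OF that] by simp
  show "dist (h z) (h w) \<le> max B L * dist z w" if "z \<in> Z" "w \<in> Z" for z w
    using assms(2)[OF that] mult_right_mono[of L "max B L" "dist z w"] by simp
qed

text \<open>The bounds are offered for all larger constants, so that several functions can later
  share the maximum of their constants. A constant of at least 1 settles the sign conditions in
  products.\<close>

lemma bounded_lipschitz_onE: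
  assumes "bounded_lipschitz_on Z h"
  obtains K where "\<And>K' z. K \<le> K' \<Longrightarrow> z \<in> Z \<Longrightarrow> norm (h z) \<le> K'"
    "\<And>K' z w. K \<le> K' \<Longrightarrow> z \<in> Z \<Longrightarrow> w \<in> Z \<Longrightarrow> dist (h z) (h w) \<le> K' * dist z w" "1 \<le> K"
proof -
  obtain K where K: "\<forall>z\<in>Z. norm (h z) \<le> K" "\<forall>z\<in>Z. \<forall>w\<in>Z. dist (h z) (h w) \<le> K * dist z w"
    using assms by (auto simp: bounded_lipschitz_on_def)
  show ?thesis
  proof (rule that[of "max K 1"])
    show "norm (h z) \<le> K'" if "max K 1 \<le> K'" "z \<in> Z" for K' z
      using K(1) that by fastforce
    show "dist (h z) (h w) \<le> K' * dist z w" if "max K 1 \<le> K'" "z \<in> Z" "w \<in> Z" for K' z w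
      using K(2) that mult_right_mono[of K K' "dist z w"] by fastforce
  qed simp
qed

lemma bounded_lipschitz_on_continuous:
  assumes "bounded_lipschitz_on Z h"
  shows "continuous_on Z h"
proof -
  obtain K where K: "\<And>K' z w. K \<le> K' \<Longrightarrow> z \<in> Z \<Longrightarrow> w \<in> Z \<Longrightarrow> dist (h z) (h w) \<le> K' * dist z w" "1 \<le> K"
    using assms by (rule bounded_lipschitz_onE) blast
  then have "K-lipschitz_on Z h" by (intro lipschitz_onI) auto
  then show ?thesis by (rule lipschitz_on_continuous_on)
qed

lemma bl_const [bl_intros]: "bounded_lipschitz_on Z (\<lambda>_. c)"
  by (rule bounded_lipschitz_onI[of _ _ "norm c" 0]) auto

lemma bl_minus [bl_intros]:
  "bounded_lipschitz_on Z u \<Longrightarrow> bounded_lipschitz_on Z (\<lambda>z. - u z)"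
  by (simp add: bounded_lipschitz_on_def dist_minus)

lemma bl_add [bl_intros]:
  assumes "bounded_lipschitz_on Z u" "bounded_lipschitz_on Z v"
  shows "bounded_lipschitz_on Z (\<lambda>z. u z + v z)"
proof -
  obtain K where K: "\<And>z. z \<in> Z \<Longrightarrow> norm (u z) \<le> K"
    "\<And>z w. z \<in> Z \<Longrightarrow> w \<in> Z \<Longrightarrow> dist (u z) (u w) \<le> K * dist z w"
    using assms(1) by (auto simp: bounded_lipschitz_on_def)
  obtain M where M: "\<And>z. z \<in> Z \<Longrightarrow> norm (v z) \<le> M"
    "\<And>z w. z \<in> Z \<Longrightarrow> w \<in> Z \<Longrightarrow> dist (v z) (v w) \<le> M * dist z w"
    using assms(2) by (auto simp: bounded_lipschitz_on_def)
  show ?thesis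
  proof (rule bounded_lipschitz_onI)
    show "norm (u z + v z) \<le> K + M" if "z \<in> Z" for z
      using K(1)[OF that] M(1)[OF that] norm_triangle_ineq[of "u z" "v z"] by linarith
    show "dist (u z + v z) (u w + v w) \<le> (K + M) * dist z w" if "z \<in> Z" "w \<in> Z" for z w
      using K(2)[OF that] M(2)[OF that] dist_triangle_add[of "u z" "v z" "u w" "v w"]
      by (simp add: distrib_right)
  qed
qed

lemma bl_diff [bl_intros]:
  "bounded_lipschitz_on Z u \<Longrightarrow> bounded_lipschitz_on Z v \<Longrightarrow> bounded_lipschitz_on Z (\<lambda>z. u z - v z)"
  using bl_add[of Z u "\<lambda>z. - v z"] bl_minus[of Z v] by simp

lemma bl_mult [bl_intros]:
  fixes u v :: "'a::metric_space \<Rightarrow> real"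
  assumes "bounded_lipschitz_on Z u" "bounded_lipschitz_on Z v"
  shows "bounded_lipschitz_on Z (\<lambda>z. u z * v z)"
proof -
  obtain K where K: "\<And>z. z \<in> Z \<Longrightarrow> norm (u z) \<le> K"
    "\<And>z w. z \<in> Z \<Longrightarrow> w \<in> Z \<Longrightarrow> dist (u z) (u w) \<le> K * dist z w" "1 \<le> K"
    using bounded_lipschitz_onE[OF assms(1)] by (metis order_refl)
  obtain M where M: "\<And>z. z \<in> Z \<Longrightarrow> norm (v z) \<le> M"
    "\<And>z w. z \<in> Z \<Longrightarrow> w \<in> Z \<Longrightarrow> dist (v z) (v w) \<le> M * dist z w" "1 \<le> M"
    using bounded_lipschitz_onE[OF assms(2)] by (metis order_refl)
  show ?thesis
  proof (rule bounded_lipschitz_onI)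
    show "norm (u z * v z) \<le> K * M" if "z \<in> Z" for z
      using K(1)[OF that] M(1)[OF that] K(3) by (auto simp: abs_mult intro: mult_mono)
    show "dist (u z * v z) (u w * v w) \<le> (2 * K * M) * dist z w" if "z \<in> Z" "w \<in> Z" for z w
    proof -
      have "u z * v z - u w * v w = u z * (v z - v w) + (u z - u w) * v w"
        by (simp add: algebra_simps)
      then have "\<bar>u z * v z - u w * v w\<bar> \<le> \<bar>u z\<bar> * \<bar>v z - v w\<bar> + \<bar>u z - u w\<bar> * \<bar>v w\<bar>"
        by (metis abs_mult abs_triangle_ineq)
      also have "\<dots> \<le> K * (M * dist z w) + (K * dist z w) * M"
        using K M that by (intro add_mono mult_mono) (auto simp: dist_real_def)
      finally show ?thesis by (simp add: dist_real_def algebra_simps)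
    qed
  qed
qed

lemma bl_power [bl_intros]:
  fixes u :: "'a::metric_space \<Rightarrow> real"
  assumes "bounded_lipschitz_on Z u"
  shows "bounded_lipschitz_on Z (\<lambda>z. u z ^ n)"
  by (induction n) (auto intro: bl_const bl_mult assms)

lemma bl_divide [bl_intros]:
  fixes u :: "'a::metric_space \<Rightarrow> real"
  assumes "bounded_lipschitz_on Z u"
  shows "bounded_lipschitz_on Z (\<lambda>z. u z / c)"
  using bl_mult[OF assms bl_const[of Z "inverse c"]] by (simp add: divide_inverse)

lemma bl_Pair [bl_intros]:
  assumes "bounded_lipschitz_on Z u" "bounded_lipschitz_on Z v"
  shows "bounded_lipschitz_on Z (\<lambda>z. (u z, v z))"
proof -
  obtain K where K: "\<And>z. z \<in> Z \<Longrightarrow> norm (u z) \<le> K"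
    "\<And>z w. z \<in> Z \<Longrightarrow> w \<in> Z \<Longrightarrow> dist (u z) (u w) \<le> K * dist z w"
    using assms(1) by (auto simp: bounded_lipschitz_on_def)
  obtain M where M: "\<And>z. z \<in> Z \<Longrightarrow> norm (v z) \<le> M"
    "\<And>z w. z \<in> Z \<Longrightarrow> w \<in> Z \<Longrightarrow> dist (v z) (v w) \<le> M * dist z w"
    using assms(2) by (auto simp: bounded_lipschitz_on_def)
  show ?thesis
  proof (rule bounded_lipschitz_onI)
    show "norm (u z, v z) \<le> K + M" if "z \<in> Z" for z
      using K(1)[OF that] M(1)[OF that] norm_Pair_le[of "u z" "v z"] by linarith
    show "dist (u z, v z) (u w, v w) \<le> (K + M) * dist z w" if "z \<in> Z" "w \<in> Z" for z w
      using K(2)[OF that] M(2)[OF that] norm_Pair_le[of "u z - u w" "v z - v w"]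
      by (simp add: distrib_right dist_norm)
  qed
qed

text \<open>The inner function may be unbounded, as is the phase t \<omega> - \<Phi> for t on the
  whole line.\<close>

lemma bl_lipschitz_comp:
  assumes h: "bounded_lipschitz_on W h" and u: "L-lipschitz_on Z u" and maps: "u ` Z \<subseteq> W"
  shows "bounded_lipschitz_on Z (\<lambda>z. h (u z))"
proof -
  obtain K where K: "\<And>z. z \<in> W \<Longrightarrow> norm (h z) \<le> K"
    "\<And>z w. z \<in> W \<Longrightarrow> w \<in> W \<Longrightarrow> dist (h z) (h w) \<le> K * dist z w" "1 \<le> K"
    using bounded_lipschitz_onE[OF h] by (metis order_refl)
  show ?thesis
  proof (rule bounded_lipschitz_onI)
    show "norm (h (u z)) \<le> K" if "z \<in> Z" for z using K(1) that maps by auto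
    show "dist (h (u z)) (h (u w)) \<le> (K * L) * dist z w" if "z \<in> Z" "w \<in> Z" for z w
    proof -
      have "dist (h (u z)) (h (u w)) \<le> K * dist (u z) (u w)" using K(2) that maps by auto
      also have "\<dots> \<le> K * (L * dist z w)"
        using K(3) lipschitz_onD[OF u that] by (intro mult_left_mono) auto
      finally show ?thesis by simp
    qed
  qed
qed

lemma bl_imp_lipschitz_on:
  assumes "bounded_lipschitz_on Z u"
  obtains L where "L-lipschitz_on Z u"
  using bounded_lipschitz_onE[OF assms] lipschitz_onI by (metis order_refl zero_le_one order_trans)

section \<open>Sine, cosine and their second-order Taylor remainders\<close>

lemma bounded_lipschitz_on_sin: "bounded_lipschitz_on UNIV (sin :: real \<Rightarrow> real)"
proof (rule bounded_lipschitz_onI)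
  show "dist (sin x) (sin y) \<le> 1 * dist x y" for x y :: real
  proof -
    have "\<bar>sin x - sin y\<bar> = 2 * (\<bar>sin ((x - y) / 2)\<bar> * \<bar>cos ((x + y) / 2)\<bar>)"
      by (simp add: sin_diff_sin abs_mult)
    also have "\<dots> \<le> 2 * (\<bar>(x - y) / 2\<bar> * 1)"
      by (intro mult_left_mono mult_mono abs_sin_x_le_abs_x) auto
    finally show ?thesis by (simp add: dist_real_def)
  qed
qed (auto intro: abs_sin_le_one)

lemma bounded_lipschitz_on_cos: "bounded_lipschitz_on UNIV (cos :: real \<Rightarrow> real)"
proof -
  have "1-lipschitz_on UNIV (\<lambda>x::real. pi / 2 - x)"
    by (rule lipschitz_onI) (auto simp: dist_real_def)
  from bl_lipschitz_comp[OF bounded_lipschitz_on_sin this] show ?thesis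
    by (simp add: sin_diff)
qed

text \<open>The integral remainder with the factor z^2 taken out, up to sign. Unlike the quotient (z
  - sin z) / z^2 it is meaningful at z = 0, and its bounds follow directly from those of sine;
  likewise for \<open>taylor_cos\<close>.\<close>

definition taylor_sin :: "real \<Rightarrow> real" where
  "taylor_sin z = integral {0..1} (\<lambda>s. (1 - s) * sin (s * z))"

definition taylor_cos :: "real \<Rightarrow> real" where
  "taylor_cos z = integral {0..1} (\<lambda>s. (1 - s) * cos (s * z))"

lemma sin_taylor: "sin z = z - z\<^sup>2 * taylor_sin z"
proof -
  \<comment> \<open>Integration by parts: the antiderivative is - (1 - s) z cos (s z) - sin (s z),
    written out at both endpoints.\<close>
  have "((\<lambda>s. z\<^sup>2 * ((1 - s) * sin (s * z))) has_integral
      (- (1 - 1) * z * cos (1 * z) - sin (1 * z)) - (- (1 - 0) * z * cos (0 * z) - sin (0 * z))) {0..1}"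
    by (rule fundamental_theorem_of_calculus)
      (auto intro!: derivative_eq_intros simp: has_real_derivative_iff_has_vector_derivative[symmetric]
        algebra_simps power2_eq_square)
  then have "integral {0..1} (\<lambda>s. z\<^sup>2 * ((1 - s) * sin (s * z))) = z - sin z"
    by (auto dest: integral_unique)
  then show ?thesis by (simp add: taylor_sin_def)
qed

lemma cos_taylor: "cos z = 1 - z\<^sup>2 * taylor_cos z"
proof -
  have "((\<lambda>s. z\<^sup>2 * ((1 - s) * cos (s * z))) has_integral
      ((1 - 1) * z * sin (1 * z) - cos (1 * z)) - ((1 - 0) * z * sin (0 * z) - cos (0 * z))) {0..1}"
    by (rule fundamental_theorem_of_calculus)
      (auto intro!: derivative_eq_intros simp: has_real_derivative_iff_has_vector_derivative[symmetric]
        algebra_simps power2_eq_square)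
  then have "integral {0..1} (\<lambda>s. z\<^sup>2 * ((1 - s) * cos (s * z))) = 1 - cos z"
    by (auto dest: integral_unique)
  then show ?thesis by (simp add: taylor_cos_def)
qed

lemma taylor_sin_0 [simp]: "taylor_sin 0 = 0"
  by (simp add: taylor_sin_def)

lemma taylor_cos_0 [simp]: "taylor_cos 0 = 1/2"
proof -
  have "((\<lambda>s::real. 1 - s) has_integral (1 - 1\<^sup>2 / 2) - (0 - 0\<^sup>2 / 2)) {0..1}"
    by (rule fundamental_theorem_of_calculus)
      (auto intro!: derivative_eq_intros simp: has_real_derivative_iff_has_vector_derivative[symmetric])
  then show ?thesis by (simp add: taylor_cos_def integral_unique)
qed

text \<open>Both the weight 1 - s and the inner factor s lie between 0 and 1, so the constant of
  \<open>u\<close> survives the integration.\<close>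

lemma bounded_lipschitz_on_integral:
  fixes u :: "real \<Rightarrow> real"
  assumes "bounded_lipschitz_on UNIV u"
  shows "bounded_lipschitz_on UNIV (\<lambda>z. integral {0..1} (\<lambda>s. (1 - s) * u (s * z)))"
proof -
  obtain K where K: "\<And>z. norm (u z) \<le> K" "\<And>z w. dist (u z) (u w) \<le> K * dist z w" "1 \<le> K"
    using bounded_lipschitz_onE[OF assms] by (metis order_refl UNIV_I)
  have cont: "continuous_on {0..1} (\<lambda>s. (1 - s) * u (s * z))" for z
    by (intro continuous_intros continuous_on_compose2[OF bounded_lipschitz_on_continuous[OF assms]]) auto
  show ?thesis
  proof (rule bounded_lipschitz_onI)
    fix z w :: real
    have "norm (integral {0..1} (\<lambda>s. (1 - s) * u (s * z))) \<le> K * (1 - 0)"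
    proof (rule integral_bound[OF _ cont])
      show "norm ((1 - s) * u (s * z)) \<le> K" if "s \<in> {0..1}" for s
        using K that mult_mono[of "\<bar>1 - s\<bar>" 1 "\<bar>u (s * z)\<bar>" K] by (auto simp: abs_mult)
    qed simp
    then show "norm (integral {0..1} (\<lambda>s. (1 - s) * u (s * z))) \<le> K" by simp
    have "integral {0..1} (\<lambda>s. (1 - s) * u (s * z)) - integral {0..1} (\<lambda>s. (1 - s) * u (s * w))
        = integral {0..1} (\<lambda>s. (1 - s) * u (s * z) - (1 - s) * u (s * w))"
      by (intro integral_diff[symmetric] integrable_continuous_real cont)
    also have "norm \<dots> \<le> (K * dist z w) * (1 - 0)"
    proof (rule integral_bound)
      show "continuous_on {0..1} (\<lambda>s. (1 - s) * u (s * z) - (1 - s) * u (s * w))"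
        by (intro continuous_intros cont)
      fix s :: real assume s: "s \<in> {0..1}"
      have "dist (u (s * z)) (u (s * w)) \<le> K * dist (s * z) (s * w)" by (rule K)
      also have "dist (s * z) (s * w) = s * dist z w"
        using s by (simp add: dist_real_def abs_mult flip: right_diff_distrib)
      also have "K * (s * dist z w) \<le> K * (1 * dist z w)"
        using s K(3) by (intro mult_left_mono mult_right_mono) auto
      finally have "\<bar>u (s * z) - u (s * w)\<bar> \<le> K * dist z w" by (simp add: dist_real_def)
      then have "\<bar>1 - s\<bar> * \<bar>u (s * z) - u (s * w)\<bar> \<le> 1 * (K * dist z w)"
        using s K(3) by (intro mult_mono) auto
      then show "norm ((1 - s) * u (s * z) - (1 - s) * u (s * w)) \<le> K * dist z w"
        by (simp add: abs_mult flip: right_diff_distrib)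
    qed simp
    finally show "dist (integral {0..1} (\<lambda>s. (1 - s) * u (s * z)))
        (integral {0..1} (\<lambda>s. (1 - s) * u (s * w))) \<le> K * dist z w"
      by (simp add: dist_norm)
  qed
qed

lemma bl_taylor [bl_intros]:
  assumes "bounded_lipschitz_on Z u"
  shows "bounded_lipschitz_on Z (\<lambda>z. taylor_sin (u z))" "bounded_lipschitz_on Z (\<lambda>z. taylor_cos (u z))"
proof -
  obtain L where L: "L-lipschitz_on Z u" using assms by (rule bl_imp_lipschitz_on)
  show "bounded_lipschitz_on Z (\<lambda>z. taylor_sin (u z))"
    using bl_lipschitz_comp[OF bounded_lipschitz_on_integral[OF bounded_lipschitz_on_sin] L]
    by (simp add: taylor_sin_def)
  show "bounded_lipschitz_on Z (\<lambda>z. taylor_cos (u z))"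
    using bl_lipschitz_comp[OF bounded_lipschitz_on_integral[OF bounded_lipschitz_on_cos] L]
    by (simp add: taylor_cos_def)
qed

lemma bl_bounded_linear:
  assumes "bounded_linear l" "bounded_lipschitz_on Z u"
  shows "bounded_lipschitz_on Z (\<lambda>z. l (u z))"
proof -
  interpret bounded_linear l by fact
  obtain B where B: "0 < B" "\<And>x. norm (l x) \<le> norm x * B" using pos_bounded by auto
  obtain K where K: "\<And>z. z \<in> Z \<Longrightarrow> norm (u z) \<le> K"
    "\<And>z w. z \<in> Z \<Longrightarrow> w \<in> Z \<Longrightarrow> dist (u z) (u w) \<le> K * dist z w"
    using assms(2) by (auto simp: bounded_lipschitz_on_def)
  show ?thesis
  proof (rule bounded_lipschitz_onI)
    show "norm (l (u z)) \<le> K * B" if "z \<in> Z" for z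
      using B(2)[of "u z"] mult_right_mono[OF K(1)[OF that], of B] B(1) by linarith
    show "dist (l (u z)) (l (u w)) \<le> (K * B) * dist z w" if "z \<in> Z" "w \<in> Z" for z w
    proof -
      have "dist (l (u z)) (l (u w)) \<le> dist (u z) (u w) * B"
        using B(2)[of "u z - u w"] by (simp add: dist_norm diff)
      also have "\<dots> \<le> (K * dist z w) * B"
        using K(2)[OF that] B(1) by (intro mult_right_mono) auto
      finally show ?thesis by (simp add: mult_ac)
    qed
  qed
qed

lemmas bl_fst [bl_intros] = bl_bounded_linear[OF bounded_linear_fst]
lemmas bl_snd [bl_intros] = bl_bounded_linear[OF bounded_linear_snd]

text \<open>Here uniformity in time is gained: the phase grows with t, but sine and cosine absorb
  this growth and keep only its Lipschitz constant.\<close>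

lemma bl_trig_phase [bl_intros]:
  fixes Z :: "(real \<times> 'b::metric_space) set"
  assumes "bounded_lipschitz_on Z u"
  shows "bounded_lipschitz_on Z (\<lambda>z. sin (fst z * \<omega> - u z))"
    and "bounded_lipschitz_on Z (\<lambda>z. cos (fst z * \<omega> - u z))"
proof -
  obtain K where K: "\<And>z w. z \<in> Z \<Longrightarrow> w \<in> Z \<Longrightarrow> dist (u z) (u w) \<le> K * dist z w" "1 \<le> K"
    using bounded_lipschitz_onE[OF assms] by (metis order_refl)
  have phase: "(\<bar>\<omega>\<bar> + K)-lipschitz_on Z (\<lambda>z. fst z * \<omega> - u z)"
  proof (rule lipschitz_onI)
    fix z w assume zw: "z \<in> Z" "w \<in> Z"
    have "dist (fst z * \<omega> - u z) (fst w * \<omega> - u w) \<le> \<bar>\<omega>\<bar> * dist (fst z) (fst w) + dist (u z) (u w)"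
    proof -
      have "fst z * \<omega> - u z - (fst w * \<omega> - u w) = \<omega> * (fst z - fst w) - (u z - u w)"
        by (simp add: algebra_simps)
      then show ?thesis
        using abs_triangle_ineq4[of "\<omega> * (fst z - fst w)" "u z - u w"] by (simp add: dist_real_def abs_mult)
    qed
    also have "\<dots> \<le> \<bar>\<omega>\<bar> * dist z w + K * dist z w"
      using K(1)[OF zw] by (intro add_mono mult_left_mono dist_fst_le) auto
    finally show "dist (fst z * \<omega> - u z) (fst w * \<omega> - u w) \<le> (\<bar>\<omega>\<bar> + K) * dist z w"
      by (simp add: distrib_right)
  qed (use K(2) in simp)
  show "bounded_lipschitz_on Z (\<lambda>z. sin (fst z * \<omega> - u z))"
    by (rule bl_lipschitz_comp[OF bounded_lipschitz_on_sin phase]) simp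
  show "bounded_lipschitz_on Z (\<lambda>z. cos (fst z * \<omega> - u z))"
    by (rule bl_lipschitz_comp[OF bounded_lipschitz_on_cos phase]) simp
qed

lemma bl_snd_UNIV:
  assumes "bounded W"
  shows "bounded_lipschitz_on (UNIV \<times> W) (\<lambda>z. snd z)"
proof -
  obtain B where "\<And>x. x \<in> W \<Longrightarrow> norm x \<le> B" using assms by (auto simp: bounded_iff)
  then show ?thesis
    by (intro bounded_lipschitz_onI[of _ _ B 1]) (auto simp: dist_snd_le intro: order_trans[OF dist_snd_le])
qed

lemma bounded_lipschitz_on_id: "bounded W \<Longrightarrow> bounded_lipschitz_on W (\<lambda>z. z)"
  using bounded_lipschitz_onI[of W "\<lambda>z. z" _ 1] by (auto simp: bounded_iff)

section \<open>First-order averaging\<close>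

text \<open>One constant \<open>K\<close> bounds all data, and \<open>g\<close> is a bounded time
  primitive of the oscillating part of the field. The assumption \<open>small\<close> fixes the time
  scale on which the error supremum can be absorbed.\<close>

lemma averaging_estimate:
  fixes y ya :: "real \<Rightarrow> 'y::real_inner" and G :: "real \<Rightarrow> real \<Rightarrow> 'y \<Rightarrow> 'y"
  assumes ab: "a \<le> b" and \<eta>: "0 < \<eta>" and K: "0 \<le> K" and small: "\<eta> * K * (b - a) \<le> 1/2"
    and y: "\<And>t. t \<in> {a..b} \<Longrightarrow> (y has_vector_derivative \<eta> *\<^sub>R G t \<eta> (y t)) (at t within {a..b})"
    and ya: "\<And>t. t \<in> {a..b} \<Longrightarrow> (ya has_vector_derivative \<eta> *\<^sub>R H (ya t)) (at t within {a..b})"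
    and yS: "\<And>t. t \<in> {a..b} \<Longrightarrow> y t \<in> S" and yaS: "\<And>t. t \<in> {a..b} \<Longrightarrow> ya t \<in> S"
    and init: "y a = ya a"
    and G_bound: "\<And>t z. z \<in> S \<Longrightarrow> norm (G t \<eta> z) \<le> K"
    and G_lip: "\<And>t z. z \<in> S \<Longrightarrow> norm (G t \<eta> z - G t 0 z) \<le> K * \<eta>"
    and H_lip: "\<And>z z'. z \<in> S \<Longrightarrow> z' \<in> S \<Longrightarrow> norm (H z - H z') \<le> K * norm (z - z')"
    and g_bound: "\<And>t z. z \<in> S \<Longrightarrow> norm (g t z) \<le> K"
    and g_lip: "\<And>t z z'. z \<in> S \<Longrightarrow> z' \<in> S \<Longrightarrow> norm (g t z - g t z') \<le> K * norm (z - z')"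
    and g_deriv: "\<And>t z. z \<in> S \<Longrightarrow> ((\<lambda>t. g t z) has_vector_derivative G t 0 z - H z) (at t)"
    and t: "t \<in> {a..b}"
  shows "norm (y t - ya t) \<le> (1 + 5 * K) * \<eta>"
proof -
  have "continuous_on {a..b} y" "continuous_on {a..b} ya"
    unfolding continuous_on_eq_continuous_within
    using y ya by (blast intro: has_vector_derivative_continuous)+
  then have "continuous_on {a..b} (\<lambda>t. norm (y t - ya t))"
    by (intro continuous_intros)
  then obtain t1 where t1: "t1 \<in> {a..b}" "\<And>s. s \<in> {a..b} \<Longrightarrow> norm (y s - ya s) \<le> norm (y t1 - ya t1)"
    using continuous_attains_sup[of "{a..b}" "\<lambda>t. norm (y t - ya t)"] ab by auto
  \<comment> \<open>\<open>M\<close> is the attained maximum of the error, and \<open>k\<close> will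
    bound the speed of the corrected difference in terms of \<open>M\<close> itself.\<close>
  define M where "M = norm (y t1 - ya t1)"
  define k where "k = \<eta> * K * (M + \<eta> + \<eta> * K)"
  have k: "0 \<le> k" using \<eta> K by (simp add: k_def M_def)
  text \<open>Subtracting the near-identity correction \<open>\<eta> g\<close> cancels the oscillating part of
    the vector field, which leaves an increment of size \<open>O(\<eta> M + \<eta>\<^sup>2)\<close>.\<close>
  define w where "w s = y s - ya s - \<eta> *\<^sub>R g s (y s)" for s
  have "norm (w t1 - w a) \<le> k * (t1 - a)"
  proof (rule pointwise_lipschitz_imp_bound)
    show "a \<le> t1" using t1 by simp
    fix s e :: real assume s: "s \<in> {a..t1}" and e: "0 < e"
    have s': "s \<in> {a..b}" using s t1 by simp
    note inS = yS[OF s'] yaS[OF s']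
    \<comment> \<open>Three first-order remainders will contribute \<open>e1\<close>, \<eta>
      \<open>e1\<close> and \<eta> K \<open>e1\<close>; the denominator makes them add up to
      \<open>e\<close>.\<close>
    define e1 where "e1 = e / (1 + \<eta> + \<eta> * K)"
    have "0 < 1 + \<eta> + \<eta> * K" using \<eta> K by (simp add: add_pos_nonneg)
    then have e1: "0 < e1" "e1 * (1 + \<eta> + \<eta> * K) = e" using e by (auto simp: e1_def)
    define dy where "dy = \<eta> *\<^sub>R G s \<eta> (y s)"
    define du where "du = dy - \<eta> *\<^sub>R H (ya s)"
    define osc where "osc = G s 0 (y s) - H (y s)"
    have "(y has_vector_derivative dy) (at s within {a..t1})"
      unfolding dy_def by (rule has_vector_derivative_within_subset[OF y]) (use s' t1 in auto)
    moreover have "((\<lambda>t. y t - ya t) has_vector_derivative du) (at s within {a..t1})"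
      unfolding du_def dy_def
      by (rule has_vector_derivative_within_subset[OF has_vector_derivative_diff[OF y ya]])
        (use s' t1 in auto)
    moreover have "((\<lambda>t. g t (y s)) has_vector_derivative osc) (at s within {a..t1})"
      unfolding osc_def by (rule has_vector_derivative_at_within[OF g_deriv[OF inS(1)]])
    ultimately have ev:
      "\<forall>\<^sub>F r in at s within {a..t1}. norm (y r - y s - (r - s) *\<^sub>R dy) \<le> e1 * \<bar>r - s\<bar>"
      "\<forall>\<^sub>F r in at s within {a..t1}. norm (y r - ya r - (y s - ya s) - (r - s) *\<^sub>R du) \<le> e1 * \<bar>r - s\<bar>"
      "\<forall>\<^sub>F r in at s within {a..t1}. norm (g r (y s) - g s (y s) - (r - s) *\<^sub>R osc) \<le> e1 * \<bar>r - s\<bar>"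
      using e1(1) unfolding has_vector_derivative_def has_derivative_within_alt2 by auto
    have dy: "norm dy \<le> \<eta> * K" using G_bound[OF inS(1)] \<eta> by (simp add: dy_def)
    \<comment> \<open>Once the oscillation is removed, only the \<eta>-dependence of
      \<open>G\<close> and the difference of \<open>H\<close> at the two solutions remain.\<close>
    have "du - \<eta> *\<^sub>R osc = \<eta> *\<^sub>R ((G s \<eta> (y s) - G s 0 (y s)) + (H (y s) - H (ya s)))"
      by (simp add: du_def dy_def osc_def algebra_simps)
    also have "norm \<dots> \<le> \<eta> * (K * \<eta> + K * M)"
    proof -
      have "norm (H (y s) - H (ya s)) \<le> K * M"
        using H_lip[OF inS] t1(2)[OF s'] K mult_left_mono[of "norm (y s - ya s)" M K] by (simp add: M_def)
      then show ?thesis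
        using G_lip[OF inS(1), of s] \<eta> norm_triangle_mono by fastforce
    qed
    finally have du: "norm (du - \<eta> *\<^sub>R osc) \<le> \<eta> * (K * \<eta> + K * M)" .
    have "\<forall>\<^sub>F r in at s within {a..t1}. r \<in> {a..t1}" by (simp add: eventually_at_filter)
    with ev show "\<forall>\<^sub>F r in at s within {a..t1}. norm (w r - w s) \<le> (k + e) * \<bar>r - s\<bar>"
    proof eventually_elim
      case (elim r)
      have "norm (y r - y s) \<le> norm (y r - y s - (r - s) *\<^sub>R dy) + norm ((r - s) *\<^sub>R dy)"
        using norm_triangle_ineq[of "y r - y s - (r - s) *\<^sub>R dy" "(r - s) *\<^sub>R dy"] by simp
      also have "\<dots> \<le> e1 * \<bar>r - s\<bar> + \<bar>r - s\<bar> * (\<eta> * K)"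
        using elim(1) dy by (auto intro!: add_mono mult_left_mono)
      finally have ydiff: "norm (y r - y s) \<le> (e1 + \<eta> * K) * \<bar>r - s\<bar>" by (simp add: algebra_simps)
      have "norm (g r (y r) - g r (y s)) \<le> K * norm (y r - y s)"
        using g_lip yS inS(1) elim(4) t1(1) by auto
      also have "\<dots> \<le> K * ((e1 + \<eta> * K) * \<bar>r - s\<bar>)"
        using ydiff K by (rule mult_left_mono)
      finally have gdiff: "norm (g r (y r) - g r (y s)) \<le> K * ((e1 + \<eta> * K) * \<bar>r - s\<bar>)" .
      \<comment> \<open>The increment of \<open>g\<close> is split into a change of time at the
        fixed state \<open>y s\<close>, which has a derivative, and a change of state at the fixed
        time \<open>r\<close>, which is only Lipschitz.\<close>
      have "w r - w s = (y r - ya r - (y s - ya s) - (r - s) *\<^sub>R du)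
          - \<eta> *\<^sub>R (g r (y s) - g s (y s) - (r - s) *\<^sub>R osc)
          - \<eta> *\<^sub>R (g r (y r) - g r (y s)) + (r - s) *\<^sub>R (du - \<eta> *\<^sub>R osc)"
        (is "_ = ?A - \<eta> *\<^sub>R ?B - \<eta> *\<^sub>R ?C + ?E")
        by (simp add: w_def algebra_simps)
      also have "norm \<dots> \<le> norm ?A + \<eta> * norm ?B + \<eta> * norm ?C + norm ?E"
        using norm_triangle_ineq[of "?A - \<eta> *\<^sub>R ?B - \<eta> *\<^sub>R ?C" ?E]
          norm_triangle_ineq4[of "?A - \<eta> *\<^sub>R ?B" "\<eta> *\<^sub>R ?C"] norm_triangle_ineq4[of ?A "\<eta> *\<^sub>R ?B"] \<eta>
        by simp
      also have "\<dots> \<le> e1 * \<bar>r - s\<bar> + \<eta> * (e1 * \<bar>r - s\<bar>) + \<eta> * (K * ((e1 + \<eta> * K) * \<bar>r - s\<bar>))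
          + \<bar>r - s\<bar> * (\<eta> * (K * \<eta> + K * M))"
        using elim(2,3) gdiff du \<eta> by (intro add_mono mult_left_mono) (auto intro!: mult_left_mono)
      also have "\<dots> = (e1 * (1 + \<eta> + \<eta> * K) + k) * \<bar>r - s\<bar>"
        by (simp add: k_def algebra_simps)
      finally show ?case by (simp add: e1(2) add.commute)
    qed
  qed
  also have "k * (t1 - a) \<le> k * (b - a)" using k t1 by (intro mult_left_mono) auto
  also have "\<dots> = (\<eta> * K * (b - a)) * (M + \<eta> + \<eta> * K)" by (simp add: k_def)
  also have "\<dots> \<le> 1/2 * (M + \<eta> + \<eta> * K)"
    using \<eta> K by (intro mult_right_mono small) (auto simp: M_def)
  finally have w: "norm (w t1 - w a) \<le> 1/2 * (M + \<eta> + \<eta> * K)" .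
  have "y t1 - ya t1 = (w t1 - w a) + (\<eta> *\<^sub>R g t1 (y t1) - \<eta> *\<^sub>R g a (y a))"
    by (simp add: w_def init)
  then have "M \<le> norm (w t1 - w a) + norm (\<eta> *\<^sub>R g t1 (y t1) - \<eta> *\<^sub>R g a (y a))"
    by (metis M_def norm_triangle_ineq)
  moreover have "norm (\<eta> *\<^sub>R g t1 (y t1) - \<eta> *\<^sub>R g a (y a)) \<le> \<eta> * K + \<eta> * K"
  proof (intro order_trans[OF norm_triangle_ineq4] add_mono)
    show "norm (\<eta> *\<^sub>R g t1 (y t1)) \<le> \<eta> * K" "norm (\<eta> *\<^sub>R g a (y a)) \<le> \<eta> * K"
      using g_bound yS t1(1) ab \<eta> by simp_all
  qed
  \<comment> \<open>With q = \<eta> K, half of m is absorbed on the left: m/2 \<le> \<eta>/2 + 5q/2.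
    This is the origin of the constant 1 + 5 K.\<close>
  moreover have "m \<le> \<eta> + 5 * q" if "m \<le> n + k" "k \<le> q + q" "n \<le> 1/2 * (m + \<eta> + q)" for m n k q
    using that by simp
  ultimately have "M \<le> \<eta> + 5 * (\<eta> * K)" using w by blast
  also have "\<dots> = (1 + 5 * K) * \<eta>" by (simp add: algebra_simps)
  finally have "M \<le> (1 + 5 * K) * \<eta>" .
  then show ?thesis using t1(2)[OF t] by (simp add: M_def)
qed

text \<open>Used for the full and for the averaged field with the same \<open>r\<close> and
  \<open>K\<close>, so that both share one time scale. The centre is (p, 1) because E = D/\<eta>
  starts at 1, and \<open>r < 1\<close> keeps E positive. The \<eta>^2 in \<open>scaling\<close>
  becomes a single \<eta> after division by \<eta>, so the whole state obeys y' = \<eta> v(t,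
  y).\<close>

locale scaled_field =
  fixes Fld :: "real \<Rightarrow> 'a::euclidean_space \<Rightarrow> real \<Rightarrow> 'a \<times> real" and X :: "'a set"
    and v :: "real \<Rightarrow> 'a \<times> real \<Rightarrow> 'a \<times> real" and p :: 'a and r K \<eta> :: real
  assumes r: "0 < r" "r < 1" and K: "0 < K" and \<eta>: "0 < \<eta>"
    and ball_X: "cball p r \<subseteq> X"
    and v_cont: "continuous_on (UNIV \<times> cball (p, 1) r) (\<lambda>(t, y). v t y)"
    and v_bound: "\<And>t y. y \<in> cball (p, 1) r \<Longrightarrow> norm (v t y) \<le> K"
    and v_lip: "\<And>t y z. y \<in> cball (p, 1) r \<Longrightarrow> z \<in> cball (p, 1) r \<Longrightarrow> dist (v t y) (v t z) \<le> K * dist y z"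
    and scaling: "\<And>t y. y \<in> cball (p, 1) r \<Longrightarrow>
      Fld t (fst y) (\<eta> * snd y) = (\<eta> *\<^sub>R fst (v t y), \<eta>\<^sup>2 * snd (v t y))"
begin

lemma cball_facts:
  fixes y :: "'a \<times> real"
  assumes "y \<in> cball (p, 1) r"
  shows "fst y \<in> X" "0 < snd y"
proof -
  have *: "dist p (fst y) \<le> r" "\<bar>1 - snd y\<bar> \<le> r"
    using assms dist_fst_le[of "(p, 1)" y] dist_snd_le[of "(p, 1)" y] by (auto simp: dist_real_def)
  show "fst y \<in> X" using *(1) ball_X by auto
  show "0 < snd y" using *(2) r by linarith
qed

text \<open>At speed \<eta> K the state moves at most r/4. Added to an initial offset below r/2 this
  stays inside the ball, and r/4 < 1/2 also serves the contraction condition.\<close>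

lemma time_scale: "\<eta> * K * (tn + r / (4 * K) / \<eta> - tn) = r / 4"
  using K \<eta> by simp

lemma existence:
  assumes \<xi>: "\<xi> \<in> ball p (r / 2)"
  shows "\<exists>x D. solution_on Fld X {tn..tn + r / (4 * K) / \<eta>} x D \<and> x tn = \<xi> \<and> D tn = \<eta>"
proof -
  let ?I = "{tn..tn + r / (4 * K) / \<eta>}"
  obtain y where y: "y tn = (\<xi>, 1)" "\<And>t. t \<in> ?I \<Longrightarrow> y t \<in> cball (p, 1) r"
    "\<And>t. t \<in> ?I \<Longrightarrow> (y has_vector_derivative \<eta> *\<^sub>R v t (y t)) (at t within ?I)"
  proof (rule picard_local_existence)
    show "tn \<le> tn + r / (4 * K) / \<eta>" "0 \<le> \<eta> * K" "0 \<le> \<eta> * K" using r K \<eta> by auto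
    have "continuous_on (?I \<times> cball (p, 1) r) (\<lambda>z. \<eta> *\<^sub>R (case z of (t, y) \<Rightarrow> v t y))"
      by (intro continuous_intros continuous_on_subset[OF v_cont]) auto
    then show "continuous_on (?I \<times> cball (p, 1) r) (\<lambda>(t, y). \<eta> *\<^sub>R v t y)"
      by (simp add: case_prod_beta)
    show "norm (\<eta> *\<^sub>R v t y) \<le> \<eta> * K" if "y \<in> cball (p, 1) r" for t y
      using v_bound[OF that] \<eta> by simp
    show "norm (\<eta> *\<^sub>R v t y - \<eta> *\<^sub>R v t z) \<le> \<eta> * K * dist y z"
      if "y \<in> cball (p, 1) r" "z \<in> cball (p, 1) r" for t y z
      using v_lip[OF that, of t] \<eta> by (simp add: dist_norm flip: scaleR_diff_right)
    show "dist (p, 1) (\<xi>, 1) + \<eta> * K * (tn + r / (4 * K) / \<eta> - tn) \<le> r"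
      using \<xi> r unfolding time_scale by (simp add: dist_Pair_Pair)
    show "\<eta> * K * (tn + r / (4 * K) / \<eta> - tn) \<le> 1 / 2"
      using r unfolding time_scale by simp
  qed blast
  have "solution_on Fld X ?I (\<lambda>t. fst (y t)) (\<lambda>t. \<eta> * snd (y t))"
    unfolding solution_on_def
  proof (intro ballI conjI)
    fix t assume t: "t \<in> ?I"
    note b = y(2)[OF t] and D = y(3)[OF t]
    show "fst (y t) \<in> X" "0 < \<eta> * snd (y t)" using cball_facts[OF b] \<eta> by auto
    show "((\<lambda>t. fst (y t)) has_vector_derivative fst (Fld t (fst (y t)) (\<eta> * snd (y t)))) (at t within ?I)"
      using bounded_linear.has_vector_derivative[OF bounded_linear_fst D] by (simp add: scaling[OF b])
    have "((\<lambda>t. \<eta> * snd (y t)) has_vector_derivative \<eta> * snd (\<eta> *\<^sub>R v t (y t))) (at t within ?I)"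
      by (intro bounded_linear.has_vector_derivative[OF bounded_linear_mult_right]
          bounded_linear.has_vector_derivative[OF bounded_linear_snd D])
    then show "((\<lambda>t. \<eta> * snd (y t)) has_vector_derivative snd (Fld t (fst (y t)) (\<eta> * snd (y t)))) (at t within ?I)"
      by (simp add: scaling[OF b] power2_eq_square mult.assoc)
  qed
  then show ?thesis using y(1) by fastforce
qed

text \<open>\<open>order_zero_averaging\<close> speaks about every solution with the given initial
  data, so an arbitrary one must be confined to the ball before the bounds on \<open>v\<close> apply
  to it.\<close>

lemma rescaled_solution:
  assumes sol: "solution_on Fld Y {tn..tn + r / (4 * K) / \<eta>} x D"
    and init: "x tn \<in> ball p (r / 2)" "D tn = \<eta>"
    and t: "t \<in> {tn..tn + r / (4 * K) / \<eta>}"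
  shows "(x t, D t / \<eta>) \<in> cball (p, 1) r"
    and "((\<lambda>t. (x t, D t / \<eta>)) has_vector_derivative \<eta> *\<^sub>R v t (x t, D t / \<eta>))
      (at t within {tn..tn + r / (4 * K) / \<eta>})"
proof -
  let ?I = "{tn..tn + r / (4 * K) / \<eta>}"
  let ?y = "\<lambda>t. (x t, D t / \<eta>)"
  let ?y' = "\<lambda>t. (fst (Fld t (x t) (D t)), snd (Fld t (x t) (D t)) / \<eta>)"
  have deriv: "(?y has_vector_derivative ?y' t) (at t within ?I)" if "t \<in> ?I" for t
    using sol that unfolding solution_on_def
    by (intro has_vector_derivative_Pair bounded_linear.has_vector_derivative[OF bounded_linear_divide]) auto
  have y': "?y' t = \<eta> *\<^sub>R v t (?y t)" if "?y t \<in> cball (p, 1) r" for t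
    using scaling[OF that, of t] \<eta> by (auto simp: prod_eq_iff power2_eq_square)
  have ball: "?y t \<in> cball (p, 1) r" if t: "t \<in> ?I" for t
  proof (rule stays_in_cball[OF deriv _ _ _ t])
    show "norm (?y' s) \<le> \<eta> * K" if "?y s \<in> cball (p, 1) r" for s
      using v_bound[OF that, of s] \<eta> by (simp only: y'[OF that]) simp
    show "dist (p, 1) (?y tn) + \<eta> * K * (tn + r / (4 * K) / \<eta> - tn) < r"
      using init r \<eta> unfolding time_scale by (simp add: dist_Pair_Pair)
  qed (use K \<eta> in auto)
  show "?y t \<in> cball (p, 1) r" by (rule ball[OF t])
  show "(?y has_vector_derivative \<eta> *\<^sub>R v t (?y t)) (at t within ?I)"
    using deriv[OF t] y'[OF ball[OF t]] by simp
qed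

end

lemma order_zero_averagingI:
  fixes F :: "real \<Rightarrow> 'a::euclidean_space \<Rightarrow> real \<Rightarrow> 'a \<times> real"
  assumes local_form: "\<And>p. p \<in> X \<Longrightarrow> \<exists>r d G H g. 0 < r \<and> r < 1 \<and> 0 < d \<and> cball p r \<subseteq> X \<and>
    (\<forall>t \<eta> y. 0 < \<eta> \<and> \<eta> < d \<and> y \<in> cball (p, 1) r \<longrightarrow>
      F t (fst y) (\<eta> * snd y) = (\<eta> *\<^sub>R fst (G (t, \<eta>, y)), \<eta>\<^sup>2 * snd (G (t, \<eta>, y)))) \<and>
    (\<forall>\<eta> y. y \<in> cball (p, 1) r \<longrightarrow>
      A (fst y) (\<eta> * snd y) = (\<eta> *\<^sub>R fst (H y), \<eta>\<^sup>2 * snd (H y))) \<and>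
    bounded_lipschitz_on (UNIV \<times> {0..d} \<times> cball (p, 1) r) G \<and>
    bounded_lipschitz_on (cball (p, 1) r) H \<and>
    bounded_lipschitz_on (UNIV \<times> cball (p, 1) r) (\<lambda>(t, y). g t y) \<and>
    (\<forall>t. \<forall>y\<in>cball (p, 1) r. ((\<lambda>t. g t y) has_vector_derivative G (t, 0, y) - H y) (at t))"
  shows "order_zero_averaging F X A (\<lambda>_. 0)"
  unfolding order_zero_averaging_def
proof (rule ballI, goal_cases)
  case (1 p)
  from local_form[OF 1] obtain r d G H g where r: "0 < r" "r < 1" and d: "0 < d" and rX: "cball p r \<subseteq> X"
    and F: "\<And>t \<eta> y. 0 < \<eta> \<Longrightarrow> \<eta> < d \<Longrightarrow> y \<in> cball (p, 1) r \<Longrightarrow>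
      F t (fst y) (\<eta> * snd y) = (\<eta> *\<^sub>R fst (G (t, \<eta>, y)), \<eta>\<^sup>2 * snd (G (t, \<eta>, y)))"
    and A: "\<And>\<eta> y. y \<in> cball (p, 1) r \<Longrightarrow>
      A (fst y) (\<eta> * snd y) = (\<eta> *\<^sub>R fst (H y), \<eta>\<^sup>2 * snd (H y))"
    and G: "bounded_lipschitz_on (UNIV \<times> {0..d} \<times> cball (p, 1) r) G"
    and H: "bounded_lipschitz_on (cball (p, 1) r) H"
    and g: "bounded_lipschitz_on (UNIV \<times> cball (p, 1) r) (\<lambda>(t, y). g t y)"
    and g': "\<And>t y. y \<in> cball (p, 1) r \<Longrightarrow>
      ((\<lambda>t. g t y) has_vector_derivative G (t, 0, y) - H y) (at t)"
    by metis
  obtain K1 where K1: "\<And>K z. K1 \<le> K \<Longrightarrow> z \<in> UNIV \<times> {0..d} \<times> cball (p, 1) r \<Longrightarrow> norm (G z) \<le> K"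
    "\<And>K z w. K1 \<le> K \<Longrightarrow> z \<in> UNIV \<times> {0..d} \<times> cball (p, 1) r \<Longrightarrow>
      w \<in> UNIV \<times> {0..d} \<times> cball (p, 1) r \<Longrightarrow> dist (G z) (G w) \<le> K * dist z w" "1 \<le> K1"
    by (rule bounded_lipschitz_onE[OF G]) blast
  obtain K2 where K2: "\<And>K z. K2 \<le> K \<Longrightarrow> z \<in> cball (p, 1) r \<Longrightarrow> norm (H z) \<le> K"
    "\<And>K z w. K2 \<le> K \<Longrightarrow> z \<in> cball (p, 1) r \<Longrightarrow> w \<in> cball (p, 1) r \<Longrightarrow> dist (H z) (H w) \<le> K * dist z w"
    by (rule bounded_lipschitz_onE[OF H]) blast
  obtain K3 where K3: "\<And>K z. K3 \<le> K \<Longrightarrow> z \<in> UNIV \<times> cball (p, 1) r \<Longrightarrow> norm (case z of (t, y) \<Rightarrow> g t y) \<le> K"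
    "\<And>K z w. K3 \<le> K \<Longrightarrow> z \<in> UNIV \<times> cball (p, 1) r \<Longrightarrow> w \<in> UNIV \<times> cball (p, 1) r \<Longrightarrow>
      dist (case z of (t, y) \<Rightarrow> g t y) (case w of (t, y) \<Rightarrow> g t y) \<le> K * dist z w"
    by (rule bounded_lipschitz_onE[OF g]) blast
  define K where "K = max K1 (max K2 K3)"
  have K: "K1 \<le> K" "K2 \<le> K" "K3 \<le> K" "1 \<le> K" "0 < K" using K1(3) by (auto simp: K_def)
  have full: "scaled_field F X (\<lambda>t y. G (t, \<eta>, y)) p r K \<eta>" if \<eta>: "0 < \<eta>" "\<eta> < d" for \<eta>
  proof
    have "continuous_on (UNIV \<times> cball (p, 1) r) (\<lambda>z. (fst z, \<eta>, snd z))"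
      by (intro continuous_intros)
    then have "continuous_on (UNIV \<times> cball (p, 1) r) (\<lambda>z. G (fst z, \<eta>, snd z))"
      by (rule continuous_on_compose2[OF bounded_lipschitz_on_continuous[OF G]]) (use \<eta> in auto)
    then show "continuous_on (UNIV \<times> cball (p, 1) r) (\<lambda>(t, y). G (t, \<eta>, y))"
      by (simp add: case_prod_beta)
    show "norm (G (t, \<eta>, y)) \<le> K" if "y \<in> cball (p, 1) r" for t y
      using K1(1)[OF K(1), of "(t, \<eta>, y)"] that \<eta> by auto
    show "dist (G (t, \<eta>, y)) (G (t, \<eta>, z)) \<le> K * dist y z"
      if "y \<in> cball (p, 1) r" "z \<in> cball (p, 1) r" for t y z
      using K1(2)[OF K(1), of "(t, \<eta>, y)" "(t, \<eta>, z)"] that \<eta> by (auto simp: dist_Pair_Pair)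
  qed (use r rX K \<eta> F in auto)
  have averaged: "scaled_field (\<lambda>t. A) UNIV (\<lambda>t. H) p r K \<eta>" if \<eta>: "0 < \<eta>" for \<eta>
  proof
    have "continuous_on (UNIV \<times> cball (p, 1) r) (\<lambda>z :: real \<times> 'a \<times> real. H (snd z))"
      by (rule continuous_on_compose2[OF bounded_lipschitz_on_continuous[OF H]])
        (auto intro: continuous_intros)
    then show "continuous_on (UNIV \<times> cball (p, 1) r) (\<lambda>(t :: real, y). H y)"
      by (simp add: case_prod_beta)
  qed (use r K \<eta> K2[OF K(2)] A in auto)
  define c where "c = r / (4 * K)"
  \<comment> \<open>The same ball serves as range of initial values for both systems: with a zero
    transformation x and x0 coincide, so x and xa start at the same point.\<close>
  define N where "N = ball p (r / 2)"
  have c: "c > 0" using r K by (simp add: c_def)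
  have avg_ex: "\<exists>xa Da. solution_on (\<lambda>t. A) UNIV {tn..tn + c / Dn} xa Da \<and> xa tn = \<xi> \<and> Da tn = Dn"
    if "0 < Dn" "\<xi> \<in> N" for tn Dn \<xi>
    using scaled_field.existence[OF averaged[OF that(1)]] that(2) by (simp add: c_def N_def)
  have full_ex: "\<exists>x D. solution_on F X {tn..tn + c / Dn} x D \<and> x tn = \<xi> \<and> D tn = Dn"
    if "0 < Dn" "Dn < d" "\<xi> \<in> N" for tn Dn \<xi>
    using scaled_field.existence[OF full[OF that(1,2)]] that(3) by (simp add: c_def N_def)
  have diff: "x differentiable_on I" if "solution_on F X I x D" for x I D
    using that unfolding solution_on_def differentiable_on_def
    by (auto simp: has_vector_derivative_def differentiable_def)
  have close: "norm (x t - xa t) \<le> (1 + 5 * K) * Dn"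
    if Dn: "0 < Dn" "Dn < d" and x: "solution_on F X {tn..tn + c / Dn} x D" "x tn = xa tn" "D tn = Dn"
      and xa: "solution_on (\<lambda>t. A) UNIV {tn..tn + c / Dn} xa Da" "xa tn \<in> N" "Da tn = Dn"
      and t: "t \<in> {tn..tn + c / Dn}" for tn Dn x D xa Da t
  proof -
    note rx = scaled_field.rescaled_solution[OF full[OF Dn] x(1)[unfolded c_def]]
    note ra = scaled_field.rescaled_solution[OF averaged[OF Dn(1)] xa(1)[unfolded c_def]]
    have "norm ((x t, D t / Dn) - (xa t, Da t / Dn)) \<le> (1 + 5 * K) * Dn"
    proof (rule averaging_estimate[where a = tn and b = "tn + c / Dn" and S = "cball (p, 1) r"
          and G = "\<lambda>t \<eta> y. G (t, \<eta>, y)" and H = H and g = g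
          and y = "\<lambda>t. (x t, D t / Dn)" and ya = "\<lambda>t. (xa t, Da t / Dn)"])
      show "Dn * K * (tn + c / Dn - tn) \<le> 1 / 2"
        using Dn K r by (simp add: c_def)
      show "norm (G (t, Dn, z)) \<le> K" if "z \<in> cball (p, 1) r" for t z
        using K1(1)[OF K(1), of "(t, Dn, z)"] that Dn by auto
      show "norm (G (t, Dn, z) - G (t, 0, z)) \<le> K * Dn" if "z \<in> cball (p, 1) r" for t z
        using K1(2)[OF K(1), of "(t, Dn, z)" "(t, 0, z)"] that Dn d
        by (auto simp: dist_Pair_Pair dist_norm)
      show "norm (H z - H z') \<le> K * norm (z - z')" if "z \<in> cball (p, 1) r" "z' \<in> cball (p, 1) r" for z z'
        using K2(2)[OF K(2) that] by (simp add: dist_norm)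
      show "norm (g t z) \<le> K" if "z \<in> cball (p, 1) r" for t z
        using K3(1)[OF K(3), of "(t, z)"] that by auto
      show "norm (g t z - g t z') \<le> K * norm (z - z')" if "z \<in> cball (p, 1) r" "z' \<in> cball (p, 1) r" for t z z'
        using K3(2)[OF K(3), of "(t, z)" "(t, z')"] that by (auto simp: dist_Pair_Pair dist_norm)
    qed (use Dn K c x xa t g' rx ra in \<open>auto simp: N_def c_def\<close>)
    then show ?thesis
      using norm_fst_le[of "x t - xa t" "D t / Dn - Da t / Dn"] by simp
  qed
  show ?case
  proof (rule exI[of _ N], rule exI[of _ N], rule exI[of _ c], rule conjI[OF c],
      rule exI[of _ d], rule conjI[OF d], intro conjI allI impI ballI)
    show "open N" "open N" "p \<in> N" "p \<in> N" using r by (auto simp: N_def)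
  next
    fix tn Dn x D
    assume Dn: "0 < Dn \<and> Dn < d" and x: "solution_on F X {tn..tn + c / Dn} x D \<and> x tn \<in> N \<and> D tn = Dn"
    then obtain xa Da where "solution_on (\<lambda>t. A) UNIV {tn..tn + c / Dn} xa Da" "xa tn = x tn" "Da tn = Dn"
      using avg_ex[of Dn "x tn" tn] by auto
    with x diff show "\<exists>x0 xa Da. averaging_representation F X A (\<lambda>_. 0) tn (tn + c / Dn) x D x0 xa Da \<and> xa tn \<in> N"
      unfolding averaging_representation_def by (intro exI[of _ x] exI[of _ xa] exI[of _ Da]) auto
  next
    fix tn Dn xa Da
    assume Dn: "0 < Dn \<and> Dn < d"
      and xa: "solution_on (\<lambda>t. A) UNIV {tn..tn + c / Dn} xa Da \<and> xa tn \<in> N \<and> Da tn = Dn"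
    then obtain x D where "solution_on F X {tn..tn + c / Dn} x D" "x tn = xa tn" "D tn = Dn"
      using full_ex[of Dn "xa tn" tn] by auto
    with xa diff show "\<exists>x D x0. averaging_representation F X A (\<lambda>_. 0) tn (tn + c / Dn) x D x0 xa Da"
      unfolding averaging_representation_def by (intro exI[of _ x] exI[of _ D]) auto
  next
    fix \<epsilon> :: real assume \<epsilon>: "0 < \<epsilon>"
    \<comment> \<open>The first entry makes the estimate \<open>close\<close> applicable, the second
      brings its bound below \<epsilon>.\<close>
    define e where "e = min d (\<epsilon> / (1 + 5 * K))"
    have e: "0 < e" "e \<le> d" using \<epsilon> d K by (auto simp: e_def)
    have "(1 + 5 * K) * e \<le> (1 + 5 * K) * (\<epsilon> / (1 + 5 * K))"
      unfolding e_def using K by (intro mult_left_mono) auto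
    then have e_\<epsilon>: "(1 + 5 * K) * e \<le> \<epsilon>" using K by simp
    show "\<exists>e>0. \<forall>tn Dn x D x0 xa Da. 0 < Dn \<and> Dn < e \<and> xa tn \<in> N \<and> Da tn = Dn \<and>
        averaging_representation F X A (\<lambda>_. 0) tn (tn + c / Dn) x D x0 xa Da \<longrightarrow>
          (\<forall>t\<in>{tn..tn + c / Dn}. norm (x0 t - xa t) \<le> \<epsilon>)"
    proof (intro exI[of _ e] conjI allI impI ballI e)
      fix tn Dn x D x0 xa Da t
      assume *: "0 < Dn \<and> Dn < e \<and> xa tn \<in> N \<and> Da tn = Dn \<and>
        averaging_representation F X A (\<lambda>_. 0) tn (tn + c / Dn) x D x0 xa Da"
        and t: "t \<in> {tn..tn + c / Dn}"
      then have rep: "averaging_representation F X A (\<lambda>_. 0) tn (tn + c / Dn) x D x0 xa Da" by blast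
      have "x s = x0 s" if "s \<in> {tn..tn + c / Dn}" for s
        using rep that by (auto simp: averaging_representation_def)
      moreover have "tn \<in> {tn..tn + c / Dn}" using * c by simp
      ultimately have "x tn = xa tn" "x t = x0 t"
        using rep t by (auto simp: averaging_representation_def)
      then have "norm (x0 t - xa t) \<le> (1 + 5 * K) * Dn"
        using close[of Dn tn x D xa Da t] * e t by (auto simp: averaging_representation_def)
      also have "\<dots> \<le> (1 + 5 * K) * e" using * K by (intro mult_left_mono) auto
      finally show "norm (x0 t - xa t) \<le> \<epsilon>" using e_\<epsilon> by simp
    qed
  qed (use avg_ex full_ex in auto)
qed

section \<open>The cosmological models\<close>

text \<open>Here \<phi> = f \<eta> E a. The term a^2 R is F / (sqrt 6 D) divided by \<eta>, where F
  = \<omega>^2 \<phi> - V'(\<phi>). In the \<Phi>-component one factor \<Omega> of a^2 has been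
  cancelled. No division by \<eta>, E or \<Omega> is left.\<close>

fun KS_scaled ::
  "real \<Rightarrow> real \<Rightarrow> real \<Rightarrow> real \<Rightarrow> real \<Rightarrow> real \<Rightarrow> real
   \<Rightarrow> real \<times> real \<times> real \<times> real \<Rightarrow> real \<Rightarrow> (real \<times> real \<times> real \<times> real) \<times> real" where
  "KS_scaled \<gamma> b \<mu> \<omega> f t \<eta> (\<Omega>, \<Sigma>, Q, \<Phi>) E =
    (let s = sin (t * \<omega> - \<Phi>);
         c = cos (t * \<omega> - \<Phi>);
         a = sqrt 6 / (\<omega> * f) * \<Omega> * s;
         R = b * \<mu> ^ 3 * E * taylor_sin (\<eta> * E * a) / sqrt 6;
         W = a\<^sup>2 * (\<mu>\<^sup>2 * f\<^sup>2 + b * f * \<mu> ^ 3 * taylor_cos (\<eta> * E * a)) / 3;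
         m = 1 - \<Sigma>\<^sup>2 - \<Omega>\<^sup>2 * c\<^sup>2 - W;
         h = - Q\<^sup>2 - 2 * \<Sigma>\<^sup>2 - (3 * \<gamma> - 2) / 2 * m - 2 * \<Omega>\<^sup>2 * c\<^sup>2 + W;
         \<delta> = Q * h - (Q + \<Sigma>) * (1 - Q\<^sup>2)
     in ((c * a\<^sup>2 * R - 3 * E * Q * \<Omega> * c\<^sup>2 - E * \<Omega> * \<delta>,
          E * (- 3 * Q * \<Sigma> - (1 - Q\<^sup>2) - \<Sigma> * \<delta>),
          E * (h - Q * \<delta>),
          s ^ 3 * (sqrt 6 / (\<omega> * f))\<^sup>2 * \<Omega> * R - 3 * E * Q * s * c),
         E\<^sup>2 * \<delta>))"

text \<open>A time primitive of the oscillating part: s c / \<omega> has derivative c^2 - s^2 and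
  c^2 / \<omega> has derivative - 2 s c.\<close>

fun KS_corrector ::
  "real \<Rightarrow> real \<Rightarrow> real \<times> real \<times> real \<times> real \<Rightarrow> real \<Rightarrow> (real \<times> real \<times> real \<times> real) \<times> real" where
  "KS_corrector \<omega> t (\<Omega>, \<Sigma>, Q, \<Phi>) E =
    (let s = sin (t * \<omega> - \<Phi>); c = cos (t * \<omega> - \<Phi>)
     in ((3 / 2 * E * Q * \<Omega> * (\<Omega>\<^sup>2 - 1) * (s * c / \<omega>),
          3 / 2 * E * Q * \<Sigma> * \<Omega>\<^sup>2 * (s * c / \<omega>),
          3 / 2 * E * \<Omega>\<^sup>2 * (Q\<^sup>2 - 1) * (s * c / \<omega>),
          3 / 2 * E * Q * (c\<^sup>2 / \<omega>)),
         - 3 / 2 * E\<^sup>2 * Q * \<Omega>\<^sup>2 * (s * c / \<omega>)))"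

lemma bl_KS_scaled [bl_intros]:
  assumes x: "bounded_lipschitz_on Z x" and E: "bounded_lipschitz_on Z E" and \<eta>: "bounded_lipschitz_on Z \<eta>"
  shows "bounded_lipschitz_on Z (\<lambda>z. KS_scaled \<gamma> b \<mu> \<omega> f (fst z) (\<eta> z) (x z) (E z))"
proof -
  \<comment> \<open>Naming each intermediate quantity lets \<open>bl_intros\<close> treat it as an
    atom; otherwise \<delta> would be expanded in four components.\<close>
  define \<Omega> where "\<Omega> z = fst (x z)" for z
  define \<Sigma> where "\<Sigma> z = fst (snd (x z))" for z
  define Q where "Q z = fst (snd (snd (x z)))" for z
  define \<Phi> where "\<Phi> z = snd (snd (snd (x z)))" for z
  have x_eq: "x z = (\<Omega> z, \<Sigma> z, Q z, \<Phi> z)" for z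
    by (simp add: \<Omega>_def \<Sigma>_def Q_def \<Phi>_def)
  have \<Omega>: "bounded_lipschitz_on Z \<Omega>" and \<Sigma>: "bounded_lipschitz_on Z \<Sigma>"
    and Q: "bounded_lipschitz_on Z Q" and \<Phi>: "bounded_lipschitz_on Z \<Phi>"
    unfolding \<Omega>_def[abs_def] \<Sigma>_def[abs_def] Q_def[abs_def] \<Phi>_def[abs_def] by (intro bl_intros x)+
  define s where "s z = sin (fst z * \<omega> - \<Phi> z)" for z
  define c where "c z = cos (fst z * \<omega> - \<Phi> z)" for z
  have s: "bounded_lipschitz_on Z s" and c: "bounded_lipschitz_on Z c"
    unfolding s_def[abs_def] c_def[abs_def] by (intro bl_intros \<Phi>)+
  define a where "a z = sqrt 6 / (\<omega> * f) * \<Omega> z * s z" for z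
  have a: "bounded_lipschitz_on Z a"
    unfolding a_def[abs_def] by (intro bl_intros \<Omega> s)
  define R where "R z = b * \<mu> ^ 3 * E z * taylor_sin (\<eta> z * E z * a z) / sqrt 6" for z
  define W where "W z = (a z)\<^sup>2 * (\<mu>\<^sup>2 * f\<^sup>2 + b * f * \<mu> ^ 3 * taylor_cos (\<eta> z * E z * a z)) / 3" for z
  have R: "bounded_lipschitz_on Z R" and W: "bounded_lipschitz_on Z W"
    unfolding R_def[abs_def] W_def[abs_def] by (intro bl_intros E \<eta> a)+
  define h where "h z = - (Q z)\<^sup>2 - 2 * (\<Sigma> z)\<^sup>2
    - (3 * \<gamma> - 2) / 2 * (1 - (\<Sigma> z)\<^sup>2 - (\<Omega> z)\<^sup>2 * (c z)\<^sup>2 - W z) - 2 * (\<Omega> z)\<^sup>2 * (c z)\<^sup>2 + W z" for z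
  have h: "bounded_lipschitz_on Z h"
    unfolding h_def[abs_def] by (intro bl_intros \<Omega> \<Sigma> Q W c)
  define \<delta> where "\<delta> z = Q z * h z - (Q z + \<Sigma> z) * (1 - (Q z)\<^sup>2)" for z
  have \<delta>: "bounded_lipschitz_on Z \<delta>"
    unfolding \<delta>_def[abs_def] by (intro bl_intros \<Sigma> Q h)
  show ?thesis
    unfolding x_eq KS_scaled.simps Let_def s_def[symmetric] c_def[symmetric] a_def[symmetric]
      R_def[symmetric] W_def[symmetric] h_def[symmetric] \<delta>_def[symmetric]
    by (intro bl_intros \<Omega> \<Sigma> Q E s c a R h \<delta>)
qed

lemma bl_KS_averaged [bl_intros]:
  assumes x: "bounded_lipschitz_on Z x" and E: "bounded_lipschitz_on Z E"
  shows "bounded_lipschitz_on Z (\<lambda>z. KS_averaged \<gamma> (x z) (E z))"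
proof -
  have x_eq: "x = (\<lambda>z. (fst (x z), fst (snd (x z)), fst (snd (snd (x z))), snd (snd (snd (x z)))))"
    by simp
  show ?thesis
    by (subst x_eq, unfold KS_averaged.simps Let_def) (intro bl_intros x E)
qed

lemma bl_KS_corrector [bl_intros]:
  assumes x: "bounded_lipschitz_on Z x" and E: "bounded_lipschitz_on Z E"
  shows "bounded_lipschitz_on Z (\<lambda>z. KS_corrector \<omega> (fst z) (x z) (E z))"
proof -
  have x_eq: "x = (\<lambda>z. (fst (x z), fst (snd (x z)), fst (snd (snd (x z))), snd (snd (snd (x z)))))"
    by simp
  show ?thesis
    by (subst x_eq, unfold KS_corrector.simps Let_def) (intro bl_intros x E)
qed

section \<open>Rescaling of the models and their time average\<close>

lemma deriv_V: "f \<noteq> 0 \<Longrightarrow> deriv (V b \<mu> f) \<phi> = 2 * \<mu>\<^sup>2 * \<phi> + b * \<mu> ^ 3 * sin (\<phi> / f)"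
  by (rule DERIV_imp_deriv) (auto simp: V_def[abs_def] intro!: derivative_eq_intros)

lemma KS_full_scaled:
  assumes pos: "0 < \<eta>" "0 < E" "0 < \<Omega>" "\<omega> \<noteq> 0" "f \<noteq> 0"
    and rel: "b * \<mu> ^ 3 = f * (\<omega>\<^sup>2 - 2 * \<mu>\<^sup>2)"
  shows "KS_full \<gamma> b \<mu> \<omega> f t (\<Omega>, \<Sigma>, Q, \<Phi>) (\<eta> * E)
    = (\<eta> *\<^sub>R fst (KS_scaled \<gamma> b \<mu> \<omega> f t \<eta> (\<Omega>, \<Sigma>, Q, \<Phi>) E),
       \<eta>\<^sup>2 * snd (KS_scaled \<gamma> b \<mu> \<omega> f t \<eta> (\<Omega>, \<Sigma>, Q, \<Phi>) E))"
proof -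
  define s where "s = sin (t * \<omega> - \<Phi>)"
  define c where "c = cos (t * \<omega> - \<Phi>)"
  define a where "a = sqrt 6 / (\<omega> * f) * \<Omega> * s"
  define z where "z = \<eta> * E * a"
  define \<phi> where "\<phi> = sqrt 6 * (\<eta> * E) * \<Omega> / \<omega> * s"
  define R where "R = b * \<mu> ^ 3 * E * taylor_sin z / sqrt 6"
  define W where "W = a\<^sup>2 * (\<mu>\<^sup>2 * f\<^sup>2 + b * f * \<mu> ^ 3 * taylor_cos z) / 3"
  define h where "h = - Q\<^sup>2 - 2 * \<Sigma>\<^sup>2 - (3 * \<gamma> - 2) / 2 * (1 - \<Sigma>\<^sup>2 - \<Omega>\<^sup>2 * c\<^sup>2 - W) - 2 * \<Omega>\<^sup>2 * c\<^sup>2 + W"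
  define \<delta> where "\<delta> = Q * h - (Q + \<Sigma>) * (1 - Q\<^sup>2)"
  have \<phi>z: "\<phi> = f * z" using pos by (simp add: \<phi>_def z_def a_def)
  have W: "V b \<mu> f \<phi> / (3 * (\<eta> * E)\<^sup>2) = W"
  proof -
    have "V b \<mu> f \<phi> = z\<^sup>2 * (\<mu>\<^sup>2 * f\<^sup>2 + b * f * \<mu> ^ 3 * taylor_cos z)"
      using pos by (simp add: V_def \<phi>z cos_taylor[of z] power_mult_distrib algebra_simps)
    also have "z\<^sup>2 = (\<eta> * E)\<^sup>2 * a\<^sup>2" by (simp add: z_def power_mult_distrib)
    finally show ?thesis using pos by (simp add: W_def)
  qed
  \<comment> \<open>By \<open>rel\<close> the linear terms cancel exactly and b \<mu>^3 (z - sin z)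
    remains. Its factor z^2 supplies the power of \<eta> that the division by D consumes.\<close>
  have F: "\<omega>\<^sup>2 * \<phi> - deriv (V b \<mu> f) \<phi> = \<eta>\<^sup>2 * E * a\<^sup>2 * (sqrt 6 * R)"
  proof -
    have "\<omega>\<^sup>2 * \<phi> - deriv (V b \<mu> f) \<phi> = f * (\<omega>\<^sup>2 - 2 * \<mu>\<^sup>2) * z - b * \<mu> ^ 3 * sin z"
      using pos by (simp add: deriv_V \<phi>z algebra_simps)
    also have "\<dots> = b * \<mu> ^ 3 * z\<^sup>2 * taylor_sin z"
      unfolding rel[symmetric] by (subst sin_taylor) (simp add: algebra_simps)
    also have "\<dots> = \<eta>\<^sup>2 * E * a\<^sup>2 * (sqrt 6 * R)"
      by (simp add: R_def z_def power2_eq_square)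
    finally show ?thesis .
  qed
  have "KS_full \<gamma> b \<mu> \<omega> f t (\<Omega>, \<Sigma>, Q, \<Phi>) (\<eta> * E) =
    ((c * (\<eta>\<^sup>2 * E * a\<^sup>2 * (sqrt 6 * R)) / (sqrt 6 * (\<eta> * E)) - 3 * (\<eta> * E) * Q * \<Omega> * c\<^sup>2 - \<eta> * E * \<Omega> * \<delta>,
      \<eta> * E * (- 3 * Q * \<Sigma> - (1 - Q\<^sup>2) - \<Sigma> * \<delta>),
      \<eta> * E * (h - Q * \<delta>),
      s * (\<eta>\<^sup>2 * E * a\<^sup>2 * (sqrt 6 * R)) / (sqrt 6 * (\<eta> * E) * \<Omega>) - 3 * (\<eta> * E) * Q * s * c),
     (\<eta> * E)\<^sup>2 * \<delta>)"
    unfolding KS_full.simps Let_def s_def[symmetric] c_def[symmetric] \<phi>_def[symmetric] W F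
      h_def[symmetric] \<delta>_def[symmetric] ..
  moreover have "KS_scaled \<gamma> b \<mu> \<omega> f t \<eta> (\<Omega>, \<Sigma>, Q, \<Phi>) E =
    ((c * a\<^sup>2 * R - 3 * E * Q * \<Omega> * c\<^sup>2 - E * \<Omega> * \<delta>,
      E * (- 3 * Q * \<Sigma> - (1 - Q\<^sup>2) - \<Sigma> * \<delta>),
      E * (h - Q * \<delta>),
      s ^ 3 * (sqrt 6 / (\<omega> * f))\<^sup>2 * \<Omega> * R - 3 * E * Q * s * c),
     E\<^sup>2 * \<delta>)"
    unfolding KS_scaled.simps Let_def s_def[symmetric] c_def[symmetric] a_def[symmetric] z_def[symmetric]
      R_def[symmetric] W_def[symmetric] h_def[symmetric] \<delta>_def[symmetric] ..
  moreover have "c * (\<eta>\<^sup>2 * E * a\<^sup>2 * (sqrt 6 * R)) / (sqrt 6 * (\<eta> * E)) = \<eta> * (c * a\<^sup>2 * R)"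
    using pos by (simp add: field_simps power2_eq_square)
  moreover have "s * (\<eta>\<^sup>2 * E * a\<^sup>2 * (sqrt 6 * R)) / (sqrt 6 * (\<eta> * E) * \<Omega>)
      = \<eta> * (s ^ 3 * (sqrt 6 / (\<omega> * f))\<^sup>2 * \<Omega> * R)"
    using pos by (simp add: a_def power2_eq_square power3_eq_cube) (simp add: field_simps)
  ultimately show ?thesis
    by (simp add: right_diff_distrib power_mult_distrib mult.assoc)
qed

lemma KS_averaged_scaled:
  "KS_averaged \<gamma> x (\<eta> * E) = (\<eta> *\<^sub>R fst (KS_averaged \<gamma> x E), \<eta>\<^sup>2 * snd (KS_averaged \<gamma> x E))"
  by (cases x) (simp add: power_mult_distrib)

text \<open>By \<open>rel\<close>, W becomes \<Omega>^2 s^2 at \<eta> = 0, so m = 1 - \<Sigma>^2 -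
  \<Omega>^2 is free of t. The remaining oscillation comes from c^2 - 1/2 = k/2 and from s c, where
  k = cos(2\<theta>). Both have mean zero over a period, which identifies \<open>KS_averaged\<close>
  as the time average.\<close>

lemma KS_scaled_limit:
  assumes "\<omega> \<noteq> 0" "f \<noteq> 0" "b * \<mu> ^ 3 = f * (\<omega>\<^sup>2 - 2 * \<mu>\<^sup>2)"
  shows "KS_scaled \<gamma> b \<mu> \<omega> f t 0 (\<Omega>, \<Sigma>, Q, \<Phi>) E - KS_averaged \<gamma> (\<Omega>, \<Sigma>, Q, \<Phi>) E =
    (let s = sin (t * \<omega> - \<Phi>); c = cos (t * \<omega> - \<Phi>); k = c\<^sup>2 - s\<^sup>2
     in ((3 / 2 * E * Q * \<Omega> * (\<Omega>\<^sup>2 - 1) * k,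
          3 / 2 * E * Q * \<Sigma> * \<Omega>\<^sup>2 * k,
          3 / 2 * E * \<Omega>\<^sup>2 * (Q\<^sup>2 - 1) * k,
          - 3 * E * Q * s * c),
         - 3 / 2 * E\<^sup>2 * Q * \<Omega>\<^sup>2 * k))"
proof -
  define s where "s = sin (t * \<omega> - \<Phi>)"
  define c where "c = cos (t * \<omega> - \<Phi>)"
  have s2: "s\<^sup>2 = 1 - c\<^sup>2" by (simp add: s_def c_def sin_squared_eq)
  have "b * f * \<mu> ^ 3 = f\<^sup>2 * (\<omega>\<^sup>2 - 2 * \<mu>\<^sup>2)"
    using assms(3) by (simp add: power2_eq_square mult.assoc mult.left_commute)
  then have "\<mu>\<^sup>2 * f\<^sup>2 + b * f * \<mu> ^ 3 * (1 / 2) = f\<^sup>2 * \<omega>\<^sup>2 / 2"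
    by (simp add: algebra_simps)
  then have W: "(sqrt 6 / (\<omega> * f) * \<Omega> * s)\<^sup>2 * (\<mu>\<^sup>2 * f\<^sup>2 + b * f * \<mu> ^ 3 * (1 / 2)) / 3 = \<Omega>\<^sup>2 * (1 - c\<^sup>2)"
    using assms(1,2) by (simp only: power_mult_distrib power_divide s2) simp
  show ?thesis
    unfolding KS_scaled.simps KS_averaged.simps Let_def s_def[symmetric] c_def[symmetric]
      mult_zero_left taylor_sin_0 taylor_cos_0 W s2
    by (simp, intro conjI; algebra)
qed

lemma KS_corrector_derivative:
  assumes "\<omega> \<noteq> 0" "f \<noteq> 0" "b * \<mu> ^ 3 = f * (\<omega>\<^sup>2 - 2 * \<mu>\<^sup>2)"
  shows "((\<lambda>t. KS_corrector \<omega> t x E) has_vector_derivative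
    KS_scaled \<gamma> b \<mu> \<omega> f t 0 x E - KS_averaged \<gamma> x E) (at t)"
proof -
  obtain \<Omega> \<Sigma> Q \<Phi> where x: "x = (\<Omega>, \<Sigma>, Q, \<Phi>)" by (cases x)
  have sc: "((\<lambda>t. sin (t * \<omega> - \<Phi>) * cos (t * \<omega> - \<Phi>) / \<omega>) has_real_derivative
      (cos (t * \<omega> - \<Phi>))\<^sup>2 - (sin (t * \<omega> - \<Phi>))\<^sup>2) (at t)"
    using assms(1) by (auto intro!: derivative_eq_intros simp: field_simps power2_eq_square)
  have cc: "((\<lambda>t. (cos (t * \<omega> - \<Phi>))\<^sup>2 / \<omega>) has_real_derivative
      - 2 * (sin (t * \<omega> - \<Phi>) * cos (t * \<omega> - \<Phi>))) (at t)"
    using assms(1) by (auto intro!: derivative_eq_intros simp: field_simps)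
  show ?thesis
    unfolding x KS_scaled_limit[OF assms] KS_corrector.simps Let_def
    by (intro has_vector_derivative_Pair;
        (rule has_vector_derivative_eq_rhs,
         rule has_vector_derivative_mult_right[OF sc[unfolded has_real_derivative_iff_has_vector_derivative]]
            has_vector_derivative_mult_right[OF cc[unfolded has_real_derivative_iff_has_vector_derivative]],
         simp))
qed

text \<open>Treats both models at once: \<open>emb\<close> and \<open>proj\<close> are identities
  for Kantowski-Sachs, while for FLRW they insert \<Sigma> = 0 and delete the \<Sigma>-component.
  Linearity lets \<open>proj\<close> commute with scaling, subtraction and the time
  derivative.\<close>

lemma reduced_KS_averaging:
  fixes emb :: "'a::euclidean_space \<Rightarrow> real \<times> real \<times> real \<times> real" and proj :: "real \<times> real \<times> real \<times> real \<Rightarrow> 'a"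
  assumes emb: "bounded_linear emb" and proj: "bounded_linear proj"
    and \<omega>: "\<omega> \<noteq> 0" and f: "f \<noteq> 0" and rel: "b * \<mu> ^ 3 = f * (\<omega>\<^sup>2 - 2 * \<mu>\<^sup>2)"
    and F: "\<And>t x D. F t x D =
      (proj (fst (KS_full \<gamma> b \<mu> \<omega> f t (emb x) D)), snd (KS_full \<gamma> b \<mu> \<omega> f t (emb x) D))"
    and A: "\<And>x D. A x D = (proj (fst (KS_averaged \<gamma> (emb x) D)), snd (KS_averaged \<gamma> (emb x) D))"
  shows "order_zero_averaging F {x. 0 < fst (emb x)} A (\<lambda>_. 0)"
proof (rule order_zero_averagingI)
  fix p assume p: "p \<in> {x. 0 < fst (emb x)}"
  define P where "P u = (proj (fst u), snd u :: real)" for u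
  have P: "bounded_linear P"
    unfolding P_def[abs_def]
    by (intro bounded_linear_Pair bounded_linear_compose[OF proj] bounded_linear_fst bounded_linear_snd)
  have "open {x. 0 < fst (emb x)}"
    by (intro open_Collect_less continuous_intros linear_continuous_on emb)
  then obtain e where e: "0 < e" "cball p e \<subseteq> {x. 0 < fst (emb x)}"
    using p by (meson open_contains_cball)
  \<comment> \<open>The bound 1/2 keeps E away from 0, and \<open>e\<close> keeps \<Omega> positive,
    as the division by \<Omega> in the full field demands.\<close>
  define r where "r = min (1/2) e"
  have r: "0 < r" "r < 1" "cball p r \<subseteq> {x. 0 < fst (emb x)}" using e by (auto simp: r_def)
  define S where "S = cball (p, 1 :: real) r"
  have S: "0 < fst (emb (fst y))" "0 < snd y" if "y \<in> S" for y
  proof -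
    have *: "dist p (fst y) \<le> r" "\<bar>1 - snd y\<bar> \<le> r"
      using that dist_fst_le[of "(p, 1)" y] dist_snd_le[of "(p, 1)" y]
      by (auto simp: S_def dist_real_def)
    show "0 < fst (emb (fst y))" using *(1) r(3) by auto
    show "0 < snd y" using *(2) r(2) by linarith
  qed
  define G where "G z = P (KS_scaled \<gamma> b \<mu> \<omega> f (fst z) (fst (snd z)) (emb (fst (snd (snd z)))) (snd (snd (snd z))))" for z
  define H where "H y = P (KS_averaged \<gamma> (emb (fst y)) (snd y))" for y
  define g where "g t y = P (KS_corrector \<omega> t (emb (fst y)) (snd y))" for t y
  have bS: "bounded S" by (simp add: S_def)
  note bl_linear = bl_bounded_linear[OF emb] bl_bounded_linear[OF P]
  \<comment> \<open>The rescaling identity holds for every \<eta> > 0, so d = 1 is a free choice;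
    only a bounded range of \<eta> matters.\<close>
  have "bounded_lipschitz_on (UNIV \<times> {0..1} \<times> S) G"
    unfolding G_def[abs_def] by (intro bl_intros bl_linear bl_snd_UNIV bounded_Times bS bounded_closed_interval)
  moreover have "bounded_lipschitz_on S H"
    unfolding H_def[abs_def] by (intro bl_intros bl_linear bounded_lipschitz_on_id bS)
  moreover have "bounded_lipschitz_on (UNIV \<times> S) (\<lambda>(t, y). g t y)"
    unfolding g_def case_prod_beta by (intro bl_intros bl_linear bl_snd_UNIV bS)
  moreover have "F t (fst y) (\<eta> * snd y) = (\<eta> *\<^sub>R fst (G (t, \<eta>, y)), \<eta>\<^sup>2 * snd (G (t, \<eta>, y)))"
    if "0 < \<eta> \<and> \<eta> < 1 \<and> y \<in> S" for t \<eta> y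
  proof -
    obtain \<Omega> \<Sigma> Q \<Phi> where x: "emb (fst y) = (\<Omega>, \<Sigma>, Q, \<Phi>)" by (cases "emb (fst y)")
    show ?thesis
      using KS_full_scaled[OF _ S(2) _ \<omega> f rel, of \<eta> y \<Omega> \<gamma> t \<Sigma> Q \<Phi>] S(1)[of y] that
      by (simp add: F G_def P_def x linear_cmul[OF bounded_linear.linear[OF proj]]
          del: KS_full.simps KS_scaled.simps)
  qed
  moreover have "A (fst y) (\<eta> * snd y) = (\<eta> *\<^sub>R fst (H y), \<eta>\<^sup>2 * snd (H y))" for \<eta> y
    by (simp add: A H_def P_def KS_averaged_scaled linear_cmul[OF bounded_linear.linear[OF proj]])
  moreover have "((\<lambda>t. g t y) has_vector_derivative G (t, 0, y) - H y) (at t)" for t y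
    using bounded_linear.has_vector_derivative[OF P KS_corrector_derivative[OF \<omega> f rel]]
    by (simp add: g_def G_def H_def linear_diff[OF bounded_linear.linear[OF P]])
  ultimately show "\<exists>r d G H g. 0 < r \<and> r < 1 \<and> 0 < d \<and> cball p r \<subseteq> {x. 0 < fst (emb x)} \<and>
    (\<forall>t \<eta> y. 0 < \<eta> \<and> \<eta> < d \<and> y \<in> cball (p, 1) r \<longrightarrow>
      F t (fst y) (\<eta> * snd y) = (\<eta> *\<^sub>R fst (G (t, \<eta>, y)), \<eta>\<^sup>2 * snd (G (t, \<eta>, y)))) \<and>
    (\<forall>\<eta> y. y \<in> cball (p, 1) r \<longrightarrow>
      A (fst y) (\<eta> * snd y) = (\<eta> *\<^sub>R fst (H y), \<eta>\<^sup>2 * snd (H y))) \<and>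
    bounded_lipschitz_on (UNIV \<times> {0..d} \<times> cball (p, 1) r) G \<and>
    bounded_lipschitz_on (cball (p, 1) r) H \<and>
    bounded_lipschitz_on (UNIV \<times> cball (p, 1) r) (\<lambda>(t, y). g t y) \<and>
    (\<forall>t. \<forall>y\<in>cball (p, 1) r. ((\<lambda>t. g t y) has_vector_derivative G (t, 0, y) - H y) (at t))"
    unfolding S_def using r zero_less_one by blast
qed

lemma continuously_differentiable_zero: "continuously_differentiable (\<lambda>_. 0)"
  unfolding continuously_differentiable_def
  by (intro exI[of _ "\<lambda>_. 0"]) (auto simp: zero_blinfun.rep_eq)

theorem theorem1:
  fixes \<gamma> b \<mu> \<omega> f :: real
  assumes "0 \<le> \<gamma>" "\<gamma> \<le> 2" "0 < b" "0 < \<mu>" "0 < \<omega>"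
    and "\<omega>\<^sup>2 > 2 * \<mu>\<^sup>2"
    and "f = b * \<mu> ^ 3 / (\<omega>\<^sup>2 - 2 * \<mu>\<^sup>2)"
  shows "(\<exists>g :: real \<times> (real \<times> real \<times> real \<times> real) \<times> real \<Rightarrow> real \<times> real \<times> real \<times> real.
            continuously_differentiable g \<and>
            order_zero_averaging (KS_full \<gamma> b \<mu> \<omega> f) {(\<Omega>, \<Sigma>, Q, \<Phi>). 0 < \<Omega>} (KS_averaged \<gamma>) g) \<and>
         (\<exists>g :: real \<times> (real \<times> real \<times> real) \<times> real \<Rightarrow> real \<times> real \<times> real.
            continuously_differentiable g \<and>
            order_zero_averaging (FLRW_full \<gamma> b \<mu> \<omega> f) {(\<Omega>, Q, \<Phi>). 0 < \<Omega>} (FLRW_averaged \<gamma>) g)"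
proof -
  \<comment> \<open>The definition of f with its denominator cleared, which is nonzero because
    \<omega>^2 > 2 \<mu>^2.\<close>
  have params: "\<omega> \<noteq> 0" "f \<noteq> 0" "b * \<mu> ^ 3 = f * (\<omega>\<^sup>2 - 2 * \<mu>\<^sup>2)"
    using assms by auto
  have "order_zero_averaging (KS_full \<gamma> b \<mu> \<omega> f) {x. 0 < fst x} (KS_averaged \<gamma>) (\<lambda>_. 0)"
    by (rule reduced_KS_averaging[OF bounded_linear_ident bounded_linear_ident params]) simp_all
  moreover have "order_zero_averaging (FLRW_full \<gamma> b \<mu> \<omega> f) {x. 0 < fst (fst x, 0 :: real, snd x)}
    (FLRW_averaged \<gamma>) (\<lambda>_. 0)"
  proof (rule reduced_KS_averaging[OF _ _ params, where proj = "\<lambda>x. (fst x, snd (snd x))"])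
    show "bounded_linear (\<lambda>x. (fst x, 0 :: real, snd x))"
      by (intro bounded_linear_Pair bounded_linear_fst bounded_linear_snd bounded_linear_zero)
    show "bounded_linear (\<lambda>x. (fst x, snd (snd x)))"
      by (intro bounded_linear_Pair bounded_linear_fst
          bounded_linear_compose[OF bounded_linear_snd bounded_linear_snd])
    show "FLRW_full \<gamma> b \<mu> \<omega> f t x D =
        ((fst (fst (KS_full \<gamma> b \<mu> \<omega> f t (fst x, 0, snd x) D)),
          snd (snd (fst (KS_full \<gamma> b \<mu> \<omega> f t (fst x, 0, snd x) D)))),
         snd (KS_full \<gamma> b \<mu> \<omega> f t (fst x, 0, snd x) D))" for t x D
      by (cases x) (simp add: case_prod_beta del: KS_full.simps)
    show "FLRW_averaged \<gamma> x D =
        ((fst (fst (KS_averaged \<gamma> (fst x, 0, snd x) D)),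
          snd (snd (fst (KS_averaged \<gamma> (fst x, 0, snd x) D)))),
         snd (KS_averaged \<gamma> (fst x, 0, snd x) D))" for x D
      by (cases x) (simp add: case_prod_beta del: KS_averaged.simps)
  qed
  moreover have "{(\<Omega>, \<Sigma>, Q, \<Phi>). 0 < \<Omega>} = {x :: real \<times> real \<times> real \<times> real. 0 < fst x}"
    "{(\<Omega>, Q, \<Phi>). 0 < \<Omega>} = {x :: real \<times> real \<times> real. 0 < fst (fst x, 0 :: real, snd x)}"
    by auto
  ultimately show ?thesis
    by (intro conjI exI[of _ "\<lambda>_. 0"] continuously_differentiable_zero) simp_all
qed

end
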